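(* For every trade-off parameter $s \in (0,1]$, define \[ \rho(s):=\frac{e^s}{s} \quad\text{and}\quad \chi(s):=\begin{cases} (e^s-1)/s, & 0< s < \ln 2, \\ \xi(s)/s, & \ln 2 \leq s \leq 1, \end{cases} \] where, for $s\in[\ln 2,1]$, $\xi(s)$ is the unique solution $\xi\in[1,e]$ of $\xi(2-\ln \xi)=e^s$. Then for every $s\in(0,1]$ there exists a randomized $\rho(s)$-robust $\chi(s)$-consistent online bidding algorithm (strategy). Moreover, the pair $(\rho(s),\chi(s))$ is Pareto-optimal: there is no $\rho'$-robust $\chi(s)$-consistent randomized strategy with $\rho'<\rho(s)$.
   Context: Online bidding: there is an unknown target $T>0$; a bidder submits strictly increasing positive bids until a bid of value at least $T$ is submitted; the cost is the sum of all submitted bids up to and including the first bid $\ge T$. A prediction $P>0$ of $T$ is given; by scale invariance it is normalized to $P=1$. Algorithms are modeled by strategies: a deterministic strategy is a bi-infinite sequence $b=(b_n)_{n\in\mathbb{Z}}$ with $0<\cdots<b_{-1}<b_0<b_1<\cdots$, and its cost on target $T>0$ is $\mathrm{cost}_b(T):=\sum_{n\le n_*} b_n$ where $n_*:=\min\{n\in\mathbb{Z}: b_n\ge T\}$. A randomized strategy $B$ is a probability distribution over deterministic strategies, and $\mathrm{cost}_B(T)$ denotes its expected cost. $B$ is $\chi$-consistent if $\mathrm{cost}_B(1)\le \chi$ and $\rho$-robust if $\mathrm{cost}_B(T)\le \rho T$ for every $T>0$. A pair $(\rho,\chi)$ is Pareto-optimal if there is a $\rho$-robust $\chi$-consistent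 strategy but no $\rho'$-robust $\chi$-consistent strategy for any $\rho'<\rho$. *)

theory Defs
  imports "HOL-Probability.Probability"
begin

definition strategy :: "(int \<Rightarrow> real) \<Rightarrow> bool" where
  "strategy b \<longleftrightarrow> (\<forall>n. 0 < b n) \<and> strict_mono b"

text \<open>Cost on target T: sum of all bids b n with n \<le> n_*, where n_* is the least index
  with b n_* \<ge> T.  Note that {n. \<forall>m<n. b m < T} = {..n_*}.  If no such least index
  exists the cost is taken to be infinite.\<close>
definition cost :: "(int \<Rightarrow> real) \<Rightarrow> real \<Rightarrow> ennreal" where
  "cost b T = (if \<exists>n. T \<le> b n \<and> (\<forall>m<n. b m < T)
     then \<integral>\<^sup>+ n. ennreal (b n) \<partial>(count_space {n. \<forall>m<n. b m < T})
     else \<infinity>)"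

definition randomized_strategy :: "(int \<Rightarrow> real) measure \<Rightarrow> bool" where
  "randomized_strategy M \<longleftrightarrow> prob_space M \<and> sets M = sets (Pi\<^sub>M UNIV (\<lambda>_. borel))
     \<and> (AE b in M. strategy b)"

definition exp_cost :: "(int \<Rightarrow> real) measure \<Rightarrow> real \<Rightarrow> ennreal" where
  "exp_cost M T = (\<integral>\<^sup>+ b. cost b T \<partial>M)"

definition robust :: "(int \<Rightarrow> real) measure \<Rightarrow> real \<Rightarrow> bool" where
  "robust M \<rho> \<longleftrightarrow> (\<forall>T>0. exp_cost M T \<le> ennreal (\<rho> * T))"

definition consistent :: "(int \<Rightarrow> real) measure \<Rightarrow> real \<Rightarrow> bool" where
  "consistent M c \<longleftrightarrow> exp_cost M 1 \<le> ennreal c"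

definition rho :: "real \<Rightarrow> real" where
  "rho s = exp s / s"

definition xi :: "real \<Rightarrow> real" where
  "xi s = (THE x. 1 \<le> x \<and> x \<le> exp 1 \<and> x * (2 - ln x) = exp s)"

definition chi :: "real \<Rightarrow> real" where
  "chi s = (if s < ln 2 then (exp s - 1) / s else xi s / s)"

end

theory Submission
  imports Defs
begin

text \<open>
  Upper bound. Bid \<open>\<beta> (n + U)\<close> for a single uniform \<open>U\<close> in \<open>(0,1)\<close> and an increasing curve \<open>\<beta>\<close>.
  The expected cost on T is the integral of \<open>\<beta> (t + 1)\<close> over \<open>\<beta> t < T\<close>, so \<open>\<rho>\<close>-robustness says that the
  integral of \<open>\<beta>\<close> up to \<open>t + 1\<close> is at most \<open>\<rho> * \<beta> t\<close>. The curve is 1 on \<open>[0, p]\<close>, equals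
  \<open>exp (s * (t - p))\<close> beyond p, and for \<open>t < 0\<close> solves the advance equation \<open>\<beta>' t = \<beta> (t + 1) / \<rho>\<close>, starting
  from the smallest height y at \<open>0-\<close> for which the backward solution stays positive; this is the height
  for which its component along the eigenfunction \<open>exp (s * t)\<close> vanishes. The expected cost on 1 is
  \<open>\<rho> * y\<close>.

  Lower bound. For an arbitrary randomized strategy let \<open>h t\<close> be the least possible expected sum of bids
  of expected number t, counted from the target 1 (the integral up to t of the quantile function of the
  bids). Then \<open>h (t + 1) \<le> \<rho> * h' t\<close>. This forces \<open>h\<close> to grow at least like \<open>exp (s * t)\<close>, and the functional
  that annihilates all components of h except the one along \<open>exp (s * t)\<close> to be nonnegative. Since
  \<open>h' \<ge> 1\<close> on \<open>[0, \<infinity>)\<close>, this bounds \<open>h 1\<close>, and hence the expected cost on 1, from below.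
\<close>

section \<open>Integral inequalities\<close>

text \<open>The products \<open>(v - u) * g u\<close> are the terms of lower Riemann sums of the
  monotone g, and the increments of h telescope. This replaces the fundamental theorem of calculus
  for an h that may fail to be differentiable.\<close>

lemma increment_ge_integral:
  fixes g h :: "real \<Rightarrow> real"
  assumes cont: "continuous_on {a..b} g"
    and mono: "\<And>u v. a \<le> u \<Longrightarrow> u \<le> v \<Longrightarrow> v \<le> b \<Longrightarrow> g u \<le> g v"
    and incr: "\<And>u v. a \<le> u \<Longrightarrow> u \<le> v \<Longrightarrow> v \<le> b \<Longrightarrow> (v - u) * g u \<le> h v - h u"
    and ab: "a \<le> b"
  shows "integral {a..b} g \<le> h b - h a"
proof -
  \<comment> \<open>The subtracted term bounds the gap between the integral and the lower sum over
    \<open>2 ^ n\<close> equal parts: a bisection halves the mesh, while the oscillations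
    \<open>g m - g u\<close> and \<open>g v - g m\<close> add up to
    \<open>g v - g u\<close>.\<close>
  have bis: "integral {u..v} g - (v - u) / 2 ^ n * (g v - g u) \<le> h v - h u"
    if "a \<le> u" "u \<le> v" "v \<le> b" for u v n
    using that
  proof (induction n arbitrary: u v)
    case 0
    have "integral {u..v} g \<le> integral {u..v} (\<lambda>_. g v)"
      using 0 mono by (intro integral_le integrable_continuous_interval continuous_on_subset[OF cont]) auto
    also have "\<dots> = (v - u) * g v" using 0 by simp
    finally show ?case using incr[OF 0] by (simp add: algebra_simps)
  next
    case (Suc n)
    define m where "m = (u + v) / 2"
    have m: "u \<le> m" "m \<le> v" using Suc.prems by (auto simp: m_def)
    have split: "integral {u..v} g = integral {u..m} g + integral {m..v} g"
      using m Suc.prems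
      by (intro Henstock_Kurzweil_Integration.integral_combine[symmetric] integrable_continuous_interval
           continuous_on_subset[OF cont]) auto
    have d: "(m - u) / 2 ^ n = (v - u) / 2 ^ Suc n" "(v - m) / 2 ^ n = (v - u) / 2 ^ Suc n"
      by (simp_all add: m_def field_simps)
    have "integral {u..m} g - (v - u) / 2 ^ Suc n * (g m - g u) \<le> h m - h u"
      using Suc.IH[of u m] Suc.prems m unfolding d by simp
    moreover have "integral {m..v} g - (v - u) / 2 ^ Suc n * (g v - g m) \<le> h v - h m"
      using Suc.IH[of m v] Suc.prems m unfolding d by simp
    ultimately show ?case
      unfolding split right_diff_distrib by linarith
  qed
  have lim: "(\<lambda>n. integral {a..b} g - (b - a) * (1 / 2) ^ n * (g b - g a)) \<longlonglongrightarrow>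
      integral {a..b} g - (b - a) * 0 * (g b - g a)"
    by (intro tendsto_intros LIMSEQ_power_zero) auto
  have "integral {a..b} g - (b - a) * 0 * (g b - g a) \<le> h b - h a"
    using bis[of a b] ab by (intro LIMSEQ_le_const2[OF lim]) (auto simp: power_divide)
  then show ?thesis by simp
qed

lemma integral_exp_neg:
  fixes a b s :: real
  assumes "a \<le> b"
  shows "integral {a..b} (\<lambda>u. s * exp (- s * u)) = exp (- s * a) - exp (- s * b)"
proof -
  have "((\<lambda>u. s * exp (- s * u)) has_integral (- exp (- s * b) - - exp (- s * a))) {a..b}"
    using assms by (intro fundamental_theorem_of_calculus)
      (auto simp flip: has_real_derivative_iff_has_vector_derivative intro!: derivative_eq_intros)
  from integral_unique[OF this] show ?thesis by simp
qed

text \<open>Integration by parts; an inequality because h need not be absolutely continuous with density i.\<close>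
lemma weighted_increment_ge_integral:
  fixes h i :: "real \<Rightarrow> real"
  assumes s: "0 < s" and ab: "a \<le> b"
    and conth: "continuous_on {a..b} h" and conti: "continuous_on {a..b} i"
    and incr: "\<And>v. a \<le> v \<Longrightarrow> v \<le> b \<Longrightarrow> integral {a..v} i \<le> h v - h a"
  shows "integral {a..b} (\<lambda>u. exp (- s * u) * i u)
    \<le> exp (- s * b) * h b - exp (- s * a) * h a + s * integral {a..b} (\<lambda>u. exp (- s * u) * h u)"
proof -
  define I where "I = (\<lambda>u. integral {a..u} i)"
  have dI: "(I has_real_derivative i u) (at u within {a..b})" if "u \<in> {a..b}" for u
    unfolding I_def has_real_derivative_iff_has_vector_derivative
    using conti that by (rule integral_has_vector_derivative)
  then have contI: "continuous_on {a..b} I"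
    by (meson DERIV_continuous_on)
  have "((\<lambda>u. exp (- s * u) * i u - s * exp (- s * u) * I u) has_integral
      (exp (- s * b) * I b - exp (- s * a) * I a)) {a..b}"
    using ab by (intro fundamental_theorem_of_calculus)
      (auto simp flip: has_real_derivative_iff_has_vector_derivative simp: algebra_simps
        intro!: derivative_eq_intros dI)
  then have "integral {a..b} (\<lambda>u. exp (- s * u) * i u - s * exp (- s * u) * I u) = exp (- s * b) * I b"
    by (simp add: integral_unique I_def)
  moreover have "integral {a..b} (\<lambda>u. exp (- s * u) * i u - s * exp (- s * u) * I u)
     = integral {a..b} (\<lambda>u. exp (- s * u) * i u) - integral {a..b} (\<lambda>u. s * exp (- s * u) * I u)"
    by (intro Henstock_Kurzweil_Integration.integral_diff integrable_continuous_interval continuous_intros conti contI)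
  \<comment> \<open>By \<open>incr\<close>, \<open>I u + h a\<close> lies below \<open>h u\<close>.
    Passing from I to h only increases this integral and the boundary term at b; the occurrences of
    \<open>h a\<close> combine to the boundary term at a.\<close>
  moreover have "integral {a..b} (\<lambda>u. s * exp (- s * u) * (I u + h a))
     \<le> integral {a..b} (\<lambda>u. s * exp (- s * u) * h u)"
    using s incr by (intro integral_le integrable_continuous_interval continuous_intros conth contI mult_left_mono)
      (auto simp: I_def algebra_simps)
  moreover have "integral {a..b} (\<lambda>u. s * exp (- s * u) * (I u + h a))
     = integral {a..b} (\<lambda>u. s * exp (- s * u) * I u) + h a * (exp (- s * a) - exp (- s * b))"
  proof -
    have "integral {a..b} (\<lambda>u. s * exp (- s * u) * (I u + h a))
      = integral {a..b} (\<lambda>u. s * exp (- s * u) * I u + h a * (s * exp (- s * u)))"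
      by (simp add: algebra_simps)
    also have "\<dots> = integral {a..b} (\<lambda>u. s * exp (- s * u) * I u) + integral {a..b} (\<lambda>u. h a * (s * exp (- s * u)))"
      by (intro Henstock_Kurzweil_Integration.integral_add integrable_continuous_interval continuous_intros contI)
    also have "integral {a..b} (\<lambda>u. h a * (s * exp (- s * u))) = h a * (exp (- s * a) - exp (- s * b))"
      using integral_exp_neg[OF ab, of s] by simp
    finally show ?thesis .
  qed
  moreover have "integral {a..b} (\<lambda>u. s * exp (- s * u) * h u) = s * integral {a..b} (\<lambda>u. exp (- s * u) * h u)"
    by (simp only: mult.assoc integral_mult_right)
  moreover have "exp (- s * b) * I b \<le> exp (- s * b) * (h b - h a)"
    using incr[of b] ab by (simp add: I_def)
  ultimately show ?thesis by (simp add: algebra_simps)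
qed


section \<open>Functions with advanced growth\<close>

text \<open>\<open>adv\<close> is the integrated form of \<open>h' t >= r * h (t + 1)\<close>. At
  the rate \<open>s * exp (- s)\<close> the function \<open>exp (s * t)\<close> satisfies it with
  equality, so a larger r encodes a robustness factor below \<open>exp s / s\<close>.\<close>

locale advance_growth =
  fixes h :: "real \<Rightarrow> real" and s r :: real
  assumes s: "0 < s" "s \<le> 1"
    and r: "s * exp (- s) < r"
    and pos: "\<And>t. 0 < h t"
    and cont: "continuous_on UNIV h"
    and adv: "\<And>t t'. t \<le> t' \<Longrightarrow> (t' - t) * (r * h (t + 1)) \<le> h t' - h t"
begin

lemma r_pos: "0 < r" using r s by (smt (verit) exp_gt_zero mult_pos_pos)

lemma cont': "continuous_on A h" using cont continuous_on_subset by blast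

lemma mono: "t \<le> t' \<Longrightarrow> h t \<le> h t'"
  using adv[of t t'] r_pos pos[of "t + 1"] by (smt (verit) mult_nonneg_nonneg)

text \<open>Bootstrapping: growth at rate c gives \<open>h (t + 1) >= exp c * h t\<close>, which
  turns the advance inequality into an ordinary differential inequality with rate
  \<open>s * exp (c - s)\<close>. Euler steps \<open>(1 + d * e) ^ n\<close> solve it in the
  limit.\<close>

lemma exp_growth_step:
  assumes c: "\<And>t t'. t \<le> t' \<Longrightarrow> exp (c * (t' - t)) * h t \<le> h t'"
    and "t \<le> t'"
  shows "exp (s * exp (c - s) * (t' - t)) * h t \<le> h t'"
proof -
  define d where "d = s * exp (c - s)"
  have d: "0 < d" using s by (simp add: d_def)
  have one: "(1 + d * (t' - t)) * h t \<le> h t'" if "t \<le> t'" for t t'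
  proof -
    have "d * h t = s * exp (- s) * (exp c * h t)" by (simp add: d_def exp_diff exp_minus field_simps)
    also have "\<dots> \<le> r * h (t + 1)" using c[of t "t + 1"] r r_pos s pos[of t]
      by (intro mult_mono) auto
    finally have "(t' - t) * (d * h t) \<le> (t' - t) * (r * h (t + 1))" using that by (intro mult_left_mono) auto
    then show ?thesis using adv[OF that] by (simp add: algebra_simps)
  qed
  have iter: "(1 + d * e) ^ n * h t \<le> h (t + real n * e)" if "0 \<le> e" for n e t
  proof (induction n)
    case (Suc n)
    have "(1 + d * e) ^ Suc n * h t \<le> (1 + d * e) * h (t + real n * e)"
      using Suc that d by (simp add: mult.assoc mult_left_mono)
    also have "\<dots> \<le> h (t + real n * e + e)" using one[of "t + real n * e" "t + real n * e + e"] that by simp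
    finally show ?case by (simp add: algebra_simps)
  qed simp
  have lim: "(\<lambda>n. (1 + d * (t' - t) / real n) ^ n * h t) \<longlonglongrightarrow> exp (d * (t' - t)) * h t"
    by (intro tendsto_intros tendsto_exp_limit_sequentially)
  have "exp (d * (t' - t)) * h t \<le> h t'"
  proof (rule LIMSEQ_le_const2[OF lim], intro exI allI impI)
    fix n :: nat assume n: "1 \<le> n"
    show "(1 + d * (t' - t) / real n) ^ n * h t \<le> h t'"
      using iter[of "(t' - t) / real n" n t] n \<open>t \<le> t'\<close> by simp
  qed
  then show ?thesis by (simp add: d_def)
qed

text \<open>The bootstrap started at rate 0 produces increasing rates bounded by s. Their limit is a
  fixed point of \<open>s * exp (x - s)\<close>, and for \<open>s <= 1\<close> the only one up to s
  is s itself.\<close>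

lemma exp_growth:
  assumes "t \<le> t'"
  shows "exp (s * (t' - t)) * h t \<le> h t'"
proof -
  define c where "c = rec_nat 0 (\<lambda>_ x. s * exp (x - s))"
  have c0: "c 0 = 0" and cS: "c (Suc n) = s * exp (c n - s)" for n by (simp_all add: c_def)
  have cs: "c n \<le> s" for n
  proof (induction n)
    case (Suc n)
    then have "s * exp (c n - s) \<le> s * 1" using s by (intro mult_left_mono) auto
    then show ?case by (simp add: cS)
  qed (use s in \<open>simp add: c0\<close>)
  have inc: "c n \<le> c (Suc n)" for n
  proof (induction n)
    case 0 then show ?case using s by (simp add: c0 cS)
  next
    case (Suc n)
    then show ?case using s by (simp only: cS[of n] cS[of "Suc n"]) simp
  qed
  have growth: "exp (c n * (t' - t)) * h t \<le> h t'" if "t \<le> t'" for n t t'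
    using that
  proof (induction n arbitrary: t t')
    case 0 then show ?case by (simp add: c0 mono)
  next
    case (Suc n) then show ?case unfolding cS by (intro exp_growth_step)
  qed
  obtain L where L: "c \<longlonglongrightarrow> L"
    using incseq_convergent[of c s] inc cs by (metis incseq_SucI)
  have "(\<lambda>n. s * exp (c n - s)) \<longlonglongrightarrow> s * exp (L - s)"
    by (intro tendsto_intros L)
  then have "L = s * exp (L - s)"
    using L LIMSEQ_unique LIMSEQ_Suc[OF L] unfolding cS by blast
  moreover have "L \<le> s" using L cs by (intro LIMSEQ_le_const2[OF L]) auto
  moreover have "L = s" if "L = s * exp (L - s)" "L \<le> s"
  proof (rule ccontr)
    assume "L \<noteq> s"
    then have lt: "L < s" using that by simp
    \<comment> \<open>The graph of exp lies strictly above its tangent at 0; with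
      \<open>s <= 1\<close> this rules out a fixed point smaller than s.\<close>
    have "s * exp (L - s) > s * (1 + (L - s))"
      using lt s exp_minus_greater[of "s - L"] by simp
    then have "L > s + s * (L - s)" using that(1) by (simp add: algebra_simps)
    then have "(1 - s) * (s - L) < 0" by (simp add: algebra_simps)
    then show False using lt s by (simp add: mult_less_0_iff)
  qed
  ultimately have "L = s" by simp
  then have "(\<lambda>n. exp (c n * (t' - t)) * h t) \<longlonglongrightarrow> exp (s * (t' - t)) * h t"
    using L by (intro tendsto_intros) auto
  then show ?thesis using growth[OF assms] by (intro LIMSEQ_le_const2) auto
qed

section \<open>The exponentially normalized function and its window functional\<close>

definition k :: "real \<Rightarrow> real" where "k t = exp (- s * t) * h t"

lemma k_pos: "0 < k t" by (simp add: k_def pos)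

lemma k_cont: "continuous_on A k" unfolding k_def by (intro continuous_intros cont')

lemma k_mono: assumes "t \<le> t'" shows "k t \<le> k t'"
proof -
  have "exp (- s * t') * (exp (s * (t' - t)) * h t) \<le> k t'"
    unfolding k_def using exp_growth[OF assms] by simp
  also have "exp (- s * t') * (exp (s * (t' - t)) * h t) = k t"
    by (simp add: k_def mult_exp_exp algebra_simps flip: mult.assoc)
  finally show ?thesis .
qed

text \<open>Constant in t when \<open>h' t = s * exp (- s) * h (t + 1)\<close>.\<close>
definition Q :: "real \<Rightarrow> real" where "Q t = k t - s * integral {t..t+1} k"

lemma k_int: "k integrable_on {a..b}"
  by (intro integrable_continuous_interval k_cont)

text \<open>Integrating the advance inequality against \<open>exp (- s * u)\<close> yields
  \<open>r * exp s\<close> times an integral of k; the moving window in Q absorbs the share s of it,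
  and the surplus remains.\<close>

lemma Q_increment:
  assumes "t \<le> t'"
  shows "(r * exp s - s) * integral {t+1..t'+1} k \<le> Q t' - Q t"
proof -
  have "integral {t..t'} (\<lambda>u. exp (- s * u) * (r * h (u + 1)))
     \<le> exp (- s * t') * h t' - exp (- s * t) * h t + s * integral {t..t'} (\<lambda>u. exp (- s * u) * h u)"
  proof (rule weighted_increment_ge_integral)
    fix v assume "t \<le> v"
    then show "integral {t..v} (\<lambda>u. r * h (u + 1)) \<le> h v - h t"
      using r_pos
      by (intro increment_ge_integral adv mult_left_mono mono continuous_intros continuous_on_compose2[OF cont]) auto
  qed (use assms s in \<open>auto intro!: cont' continuous_intros continuous_on_compose2[OF cont]\<close>)
  moreover have "integral {t..t'} (\<lambda>u. exp (- s * u) * (r * h (u + 1))) = r * exp s * integral {t+1..t'+1} k"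
  proof -
    have "(\<lambda>u. exp (- s * u) * (r * h (u + 1))) = (\<lambda>u. (r * exp s) * k (u + 1))"
      by (rule ext) (simp add: k_def exp_add exp_minus exp_diff field_simps)
    moreover have "integral {t..t'} (\<lambda>u. k (u + 1)) = integral {t+1..t'+1} k"
      using integral_shift_real_ivl[of "t+1" 1 "t'+1" k] by simp
    ultimately show ?thesis by (simp only: integral_mult_right)
  qed
  moreover have "integral {t..t+1} k + integral {t+1..t'+1} k = integral {t..t'} k + integral {t'..t'+1} k"
  proof -
    have "integral {t..t+1} k + integral {t+1..t'+1} k = integral {t..t'+1} k"
      using assms k_int by (intro Henstock_Kurzweil_Integration.integral_combine) auto
    also have "\<dots> = integral {t..t'} k + integral {t'..t'+1} k"
      using assms k_int by (intro Henstock_Kurzweil_Integration.integral_combine[symmetric]) auto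
    finally show ?thesis .
  qed
  ultimately show ?thesis
    unfolding Q_def k_def[symmetric] by (smt (verit) distrib_left left_diff_distrib)
qed

lemma integral_k_nonneg: "0 \<le> integral {a..b} k"
  using k_pos by (intro integral_nonneg k_int) (auto intro: less_imp_le)

lemma rate_exp_gt: "0 < r * exp s - s"
  using r by (simp add: exp_minus field_simps)

text \<open>Q is nondecreasing, so a negative value persists at all earlier times. Since k is
  nondecreasing and \<open>s <= 1\<close>, k would then drop by at least \<open>- Q t\<close> with
  every unit step into the past and lose its positivity.\<close>

lemma Q_nonneg: "0 \<le> Q t"
proof (rule ccontr)
  assume "\<not> 0 \<le> Q t"
  then have neg: "Q t < 0" by simp
  have step: "k u \<le> k (u + 1) + Q t" if "u \<le> t" for u
  proof -
    have "Q u \<le> Q t" using Q_increment[OF that] rate_exp_gt integral_k_nonneg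
      by (smt (verit) mult_nonneg_nonneg)
    moreover have "s * integral {u..u+1} k \<le> 1 * k (u + 1)"
    proof (intro mult_mono)
      have "integral {u..u+1} k \<le> integral {u..u+1} (\<lambda>_. k (u + 1))"
        by (intro integral_le k_int) (auto intro: k_mono)
      then show "integral {u..u+1} k \<le> k (u + 1)" by simp
    qed (use s integral_k_nonneg in auto)
    ultimately show ?thesis by (simp add: Q_def)
  qed
  have iter: "k (t - real n) \<le> k t + real n * Q t" for n
  proof (induction n)
    case (Suc n)
    then show ?case using step[of "t - real (Suc n)"] by (simp add: algebra_simps)
  qed simp
  obtain n :: nat where "k t < real n * (- Q t)"
    using neg ex_less_of_nat_mult[of "- Q t" "k t"] by auto
  then show False using iter[of n] k_pos[of "t - real n"] by simp
qed

text \<open>The strict inequality for r makes Q increase properly from the nonnegative value at -1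
  to its value at 0.\<close>

lemma Q_pos: "0 < Q 0"
proof -
  have "k 0 \<le> integral {0..1} k"
  proof -
    have "integral {0..1} (\<lambda>_::real. k 0) \<le> integral {0..1} k"
      by (intro integral_le k_int) (auto intro: k_mono)
    then show ?thesis by simp
  qed
  then have "0 < (r * exp s - s) * integral {0..1} k"
    using rate_exp_gt k_pos[of 0] by (intro mult_pos_pos) auto
  then show ?thesis using Q_increment[of "-1" 0] Q_nonneg[of "-1"] by simp
qed

text \<open>Integrate the slope of h against \<open>exp (- s * u)\<close> over
  \<open>[0, 1]\<close>, split at p. On \<open>[0, p]\<close> the slope is at least 1; on
  \<open>[p, 1]\<close> the advance inequality with \<open>exp_growth\<close> from 1 bounds it below
  by a multiple of \<open>h 1\<close>. The boundary terms at p cancel and \<open>Q_pos\<close>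
  disposes of \<open>h 0\<close>, so a linear inequality for \<open>h 1\<close> remains.\<close>

lemma value_at_one_gt:
  assumes slope: "\<And>t t'. 0 \<le> t \<Longrightarrow> t \<le> t' \<Longrightarrow> t' - t \<le> h t' - h t"
    and p: "0 \<le> p" "p \<le> 1"
  shows "exp s * (1 - exp (- s * p)) / s < h 1 * (1 - s * (1 - p))"
proof -
  have first: "integral {0..p} (\<lambda>u. exp (- s * u) * 1)
     \<le> exp (- s * p) * h p - exp (- s * 0) * h 0 + s * integral {0..p} (\<lambda>u. exp (- s * u) * h u)"
    using s p slope[of 0] by (intro weighted_increment_ge_integral cont') auto
  have second: "integral {p..1} (\<lambda>u. exp (- s * u) * (s * exp (- s) * exp (s * u) * h 1))
     \<le> exp (- s * 1) * h 1 - exp (- s * p) * h p + s * integral {p..1} (\<lambda>u. exp (- s * u) * h u)"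
  proof (intro weighted_increment_ge_integral cont' increment_ge_integral continuous_intros)
    fix u v :: real assume uv: "p \<le> u" "u \<le> v"
    have "s * exp (- s) * (exp (s * u) * h 1) \<le> r * h (u + 1)"
      using exp_growth[of 1 "u + 1"] r s p uv pos[of 1] r_pos by (intro mult_mono) auto
    then have "(v - u) * (s * exp (- s) * (exp (s * u) * h 1)) \<le> (v - u) * (r * h (u + 1))"
      using uv by (intro mult_left_mono) auto
    then show "(v - u) * (s * exp (- s) * exp (s * u) * h 1) \<le> h v - h u"
      using adv[OF uv(2)] by (simp add: mult.assoc)
  next
    fix u v :: real assume "u \<le> v"
    then show "s * exp (- s) * exp (s * u) * h 1 \<le> s * exp (- s) * exp (s * v) * h 1"
      using s pos[of 1] by simp
  qed (use s p in auto)
  define X where "X = integral {0..p} (\<lambda>u. exp (- s * u) * h u)"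
  define Y where "Y = integral {p..1} (\<lambda>u. exp (- s * u) * h u)"
  have i1: "integral {0..p} (\<lambda>u. exp (- s * u) * 1) = (1 - exp (- s * p)) / s"
    using integral_exp_neg[OF p(1), of s] s by (simp add: field_simps)
  have "(\<lambda>u. exp (- s * u) * (s * exp (- s) * exp (s * u) * h 1)) = (\<lambda>_. s * exp (- s) * h 1)"
    by (rule ext) (simp add: exp_minus field_simps)
  then have i2: "integral {p..1} (\<lambda>u. exp (- s * u) * (s * exp (- s) * exp (s * u) * h 1))
      = (1 - p) * (s * exp (- s) * h 1)"
    using p by simp
  have "X + Y = integral {0..1} k"
    unfolding k_def X_def Y_def using p
    by (intro Henstock_Kurzweil_Integration.integral_combine integrable_continuous_interval continuous_intros cont') auto
  moreover have "s * integral {0..1} k < h 0" using Q_pos by (simp add: Q_def k_def)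
  ultimately have "s * X + s * Y < h 0" by (metis distrib_left)
  then have "(1 - exp (- s * p)) / s < exp (- s) * h 1 - (1 - p) * (s * exp (- s) * h 1)"
    using first[folded X_def] second[folded Y_def] unfolding i1 i2 by simp
  then have "exp s * ((1 - exp (- s * p)) / s) < exp s * (exp (- s) * h 1 - (1 - p) * (s * exp (- s) * h 1))"
    by (intro mult_strict_left_mono) simp_all
  also have "\<dots> = h 1 * (1 - s * (1 - p))" by (simp add: exp_minus field_simps)
  finally show ?thesis by simp
qed

end

section \<open>Costs of deterministic strategies\<close>

text \<open>The index set depends on b; encoding it by an indicator over all integers makes the sum
  visibly measurable in b and ready for exchange with other integrals.\<close>

definition bid_sum :: "(int \<Rightarrow> real) \<Rightarrow> real \<Rightarrow> ennreal" where
  "bid_sum b T = (\<integral>\<^sup>+ n. ennreal (b n) * indicator {n. b (n - 1) < T} n \<partial>count_space UNIV)"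

lemma strategy_less_iff: "strategy b \<Longrightarrow> b m < b n \<longleftrightarrow> m < n"
  unfolding strategy_def by (simp add: strict_mono_less)

lemma strategy_le_iff: "strategy b \<Longrightarrow> b m \<le> b n \<longleftrightarrow> m \<le> n"
  unfolding strategy_def by (simp add: strict_mono_less_eq)

lemma cost_strategy:
  assumes "strategy b"
  shows "cost b T = (if \<exists>n. T \<le> b n \<and> b (n - 1) < T then bid_sum b T else \<infinity>)"
proof -
  have below: "(\<forall>m<n. b m < T) \<longleftrightarrow> b (n - 1) < T" for n
    using strategy_le_iff[OF assms, of _ "n - 1"] by (auto intro: order.strict_trans1)
  have "(\<integral>\<^sup>+ n. ennreal (b n) \<partial>count_space {n. b (n - 1) < T}) = bid_sum b T"
    unfolding bid_sum_def by (simp add: nn_integral_count_space_indicator)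
  then show ?thesis unfolding cost_def below by metis
qed

lemma cost_finiteD:
  assumes b: "strategy b" and fin: "cost b T < \<infinity>"
  shows "\<exists>n. T \<le> b n \<and> b (n - 1) < T" "bid_sum b T < \<infinity>"
proof -
  show ex: "\<exists>n. T \<le> b n \<and> b (n - 1) < T"
  proof (rule ccontr)
    assume "\<not> ?thesis"
    then have "cost b T = \<infinity>" by (simp only: cost_strategy[OF b] if_False)
    then show False using fin by simp
  qed
  show "bid_sum b T < \<infinity>" using fin ex by (simp only: cost_strategy[OF b] if_True)
qed

section \<open>Measurability of bid sums and of the first sufficient index\<close>

lemma bid_measurable [measurable]: "(\<lambda>b. b n) \<in> borel_measurable (Pi\<^sub>M UNIV (\<lambda>_. borel))"
  by (rule measurable_component_singleton) simp

lemma strategy_measurable [measurable]: "Measurable.pred (Pi\<^sub>M UNIV (\<lambda>_. borel)) strategy"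
proof -
  have eq: "strategy = (\<lambda>b. (\<forall>n. 0 < b n) \<and> (\<forall>m n. m < n \<longrightarrow> b m < b n))"
    by (auto simp: strategy_def strict_mono_def)
  show ?thesis unfolding eq by measurable
qed

lemma bid_sum_measurable [measurable]: "(\<lambda>b. bid_sum b T) \<in> borel_measurable (Pi\<^sub>M UNIV (\<lambda>_. borel))"
proof -
  have "(\<lambda>b. bid_sum b T) = (\<lambda>b. \<Sum>i. ennreal (b (int_decode i)) * indicator {n. b (n - 1) < T} (int_decode i))"
    unfolding bid_sum_def
    by (simp add: nn_integral_count_space_nat flip: nn_integral_bij_count_space[OF bij_int_decode])
  then show ?thesis by (simp add: indicator_def)
qed

text \<open>The conjunct \<open>strategy b\<close> makes the described index unique for every b, not
  just for almost every one, which is what measurability of the description operator asks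
  for.\<close>

definition first_bid :: "(int \<Rightarrow> real) \<Rightarrow> real \<Rightarrow> int" where
  "first_bid b T = (THE n. strategy b \<and> T \<le> b n \<and> b (n - 1) < T)"

lemma first_bid_unique:
  assumes "strategy b" "T \<le> b m" "b (m - 1) < T" "T \<le> b n" "b (n - 1) < T"
  shows "m = n"
proof -
  have "b (m - 1) < b n" "b (n - 1) < b m" using assms by auto
  then show ?thesis using strategy_less_iff[OF assms(1)] by force
qed

lemma first_bid_measurable [measurable]:
  "(\<lambda>b. first_bid b T) \<in> Pi\<^sub>M UNIV (\<lambda>_. borel) \<rightarrow>\<^sub>M count_space UNIV"
  unfolding first_bid_def
  by (rule measurable_THE[where I = UNIV]) (auto intro: first_bid_unique)

section \<open>Partial sums of bids and strategies with finite costs\<close>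

definition sum_below :: "(int \<Rightarrow> real) \<Rightarrow> int \<Rightarrow> real" where
  "sum_below b m = (\<Sum>k. b (m - 1 - int k))"

lemma sum_below_measurable [measurable]:
  "(\<lambda>b. sum_below b m) \<in> borel_measurable (Pi\<^sub>M UNIV (\<lambda>_. borel))"
  unfolding sum_below_def by measurable

text \<open>The regularity that robustness forces almost surely. Summability is stated at index 0
  only; shifting carries it to every index.\<close>

definition finite_cost :: "(int \<Rightarrow> real) \<Rightarrow> bool" where
  "finite_cost b \<longleftrightarrow> strategy b \<and> (\<forall>T>0. \<exists>n. T \<le> b n \<and> b (n - 1) < T) \<and> summable (\<lambda>k. b (- int k))"

lemma bid_sum_eq:
  assumes "strategy b" "T \<le> b n" "b (n - 1) < T"
  shows "bid_sum b T = (\<Sum>k. ennreal (b (n - int k)))"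
proof -
  have eq: "{m. b (m - 1) < T} = {..n}"
  proof (intro set_eqI iffI CollectI)
    fix m assume "m \<in> {m. b (m - 1) < T}"
    then have "b (m - 1) < b n" using assms by auto
    then show "m \<in> {..n}" using strategy_less_iff[OF assms(1)] by simp
  next
    fix m assume "m \<in> {..n}"
    then have "b (m - 1) \<le> b (n - 1)" using strategy_le_iff[OF assms(1)] by simp
    then show "b (m - 1) < T" using assms by simp
  qed
  have bij: "bij_betw (\<lambda>k. n - int k) UNIV {..n}"
    by (rule bij_betwI[where g = "\<lambda>m. nat (n - m)"]) auto
  have "bid_sum b T = (\<integral>\<^sup>+ m. ennreal (b m) \<partial>count_space {..n})"
    unfolding bid_sum_def eq by (simp add: nn_integral_count_space_indicator)
  also have "\<dots> = (\<Sum>k. ennreal (b (n - int k)))"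
    by (simp add: nn_integral_count_space_nat flip: nn_integral_bij_count_space[OF bij])
  finally show ?thesis .
qed

lemma summable_shift_int:
  fixes b :: "int \<Rightarrow> real"
  assumes "summable (\<lambda>k. b (m - int k))"
  shows "summable (\<lambda>k. b (n - int k))"
proof (cases "n \<le> m")
  case True
  have "summable (\<lambda>k. b (m - int (k + nat (m - n))))" using assms by (subst summable_iff_shift)
  then show ?thesis using True by (simp add: algebra_simps)
next
  case False
  have "summable (\<lambda>k. b (n - int (k + nat (n - m))))" using assms False by (simp add: algebra_simps)
  then show ?thesis by (subst (asm) summable_iff_shift)
qed

context
  fixes b assumes fc: "finite_cost b"
begin

lemma fc_strategy: "strategy b" using fc by (simp add: finite_cost_def)

lemma bid_pos: "0 < b n" using fc_strategy by (simp add: strategy_def)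

lemma first_bid:
  assumes "0 < T"
  shows "T \<le> b (first_bid b T)" "b (first_bid b T - 1) < T"
proof -
  obtain n where n: "T \<le> b n \<and> b (n - 1) < T" using fc assms by (auto simp: finite_cost_def)
  have "strategy b \<and> T \<le> b (first_bid b T) \<and> b (first_bid b T - 1) < T"
    unfolding first_bid_def
    by (rule theI[where a = n]) (use n fc_strategy in \<open>auto intro: first_bid_unique\<close>)
  then show "T \<le> b (first_bid b T)" "b (first_bid b T - 1) < T" by auto
qed

lemma bid_less_iff:
  assumes "0 < T"
  shows "b n < T \<longleftrightarrow> n < first_bid b T"
proof
  assume "b n < T"
  then have "b n < b (first_bid b T)" using first_bid[OF assms] by simp
  then show "n < first_bid b T" using strategy_less_iff[OF fc_strategy] by simp
next
  assume "n < first_bid b T"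
  then have "b n \<le> b (first_bid b T - 1)" using strategy_le_iff[OF fc_strategy] by simp
  then show "b n < T" using first_bid[OF assms] by simp
qed

lemma summable_bids: "summable (\<lambda>k. b (m - int k))"
  using fc summable_shift_int[of b 0 m] by (simp add: finite_cost_def)

lemma sum_below_step: "sum_below b (m + 1) = sum_below b m + b m"
proof -
  have "(\<Sum>k. b (m - int (Suc k))) = (\<Sum>k. b (m - int k)) - b (m - int 0)"
    by (rule suminf_split_head[OF summable_bids])
  then show ?thesis by (simp add: sum_below_def algebra_simps)
qed

lemma sum_below_pos: "0 < sum_below b m"
  unfolding sum_below_def using summable_bids bid_pos by (intro suminf_pos) auto

text \<open>The partial sums form a convex sequence with the bids as slopes. Bids before
  \<open>first_bid b \<theta>\<close> are smaller than \<open>\<theta>\<close> and later ones are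
  not, so the line of slope \<open>\<theta>\<close> through that index supports the
  sequence.\<close>

lemma sum_below_ge:
  assumes "0 < \<theta>"
  shows "sum_below b (first_bid b \<theta>) + \<theta> * real_of_int (m - first_bid b \<theta>) \<le> sum_below b m"
proof (cases "first_bid b \<theta> \<le> m")
  case True
  then show ?thesis
  proof (induction m rule: int_ge_induct)
    case (step i)
    have "\<theta> \<le> b i" using step bid_less_iff[OF assms, of i] by auto
    then show ?case using step sum_below_step[of i] by (simp add: algebra_simps)
  qed simp
next
  case False
  then have "m \<le> first_bid b \<theta>" by simp
  then show ?thesis
  proof (induction m rule: int_le_induct)
    case (step i)
    have "b (i - 1) < \<theta>" using step bid_less_iff[OF assms, of "i - 1"] by auto
    then show ?case using step sum_below_step[of "i - 1"] by (simp add: algebra_simps)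
  qed simp
qed

lemma cost_eq: "0 < T \<Longrightarrow> cost b T = ennreal (sum_below b (first_bid b T + 1))"
  using first_bid[of T] bid_pos
  by (auto simp: cost_strategy[OF fc_strategy] bid_sum_eq[OF fc_strategy first_bid] sum_below_def
      intro!: suminf_ennreal2 summable_bids less_imp_le)

lemma first_bid_mono: "0 < \<theta> \<Longrightarrow> \<theta> \<le> T \<Longrightarrow> first_bid b \<theta> \<le> first_bid b T"
  using bid_less_iff[of \<theta> "first_bid b \<theta> - 1"] bid_less_iff[of T "first_bid b \<theta> - 1"]
  by auto

text \<open>Either the bid that covers T misses R and at least one further index is passed, or it
  reaches R and the left side is at most 0.\<close>

lemma first_bid_gap:
  assumes "0 < T" "T \<le> R"
  shows "1 - b (first_bid b T) / R \<le> real_of_int (first_bid b R - first_bid b T)"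
proof (cases "b (first_bid b T) < R")
  case True
  then have "first_bid b T < first_bid b R" using assms bid_less_iff[of R] by auto
  then have "1 \<le> real_of_int (first_bid b R - first_bid b T)" by linarith
  moreover have "0 \<le> b (first_bid b T) / R" using bid_pos[of "first_bid b T"] assms by simp
  ultimately show ?thesis by linarith
next
  case False
  then have "1 \<le> b (first_bid b T) / R" using assms by (simp add: field_simps)
  moreover have "0 \<le> real_of_int (first_bid b R - first_bid b T)" using first_bid_mono[OF assms] by simp
  ultimately show ?thesis by linarith
qed

end

lemma crossing_exists:
  assumes b: "strategy b" and m: "b m < T" and n: "T \<le> b n"
  shows "\<exists>n. T \<le> b n \<and> b (n - 1) < T"
proof -
  have "m < n" using m n strategy_less_iff[OF b, of m n] by linarith
  then have ex: "T \<le> b (m + int (nat (n - m)))" using n by simp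
  define k where "k = (LEAST k. T \<le> b (m + int k))"
  have k: "T \<le> b (m + int k)" unfolding k_def by (rule LeastI[where P = "\<lambda>k. T \<le> b (m + int k)", OF ex])
  then have "k \<noteq> 0" using m by (intro notI) simp
  then have "\<not> T \<le> b (m + int (k - 1))" unfolding k_def
    using not_less_Least[of "k - 1" "\<lambda>k. T \<le> b (m + int k)"] by (simp add: k_def)
  then show "\<exists>n. T \<le> b n \<and> b (n - 1) < T" using k \<open>k \<noteq> 0\<close>
    by (intro exI[of _ "m + int k"]) (simp add: of_nat_diff algebra_simps)
qed

text \<open>Countably many targets, accumulating at 0 and at infinity, control all others; for
  countably many targets a common null set can be discarded.\<close>

lemma finite_costI:
  assumes b: "strategy b"
    and fin: "\<And>j::nat. cost b (real (Suc j)) < \<infinity>" "\<And>j::nat. cost b (1 / real (Suc j)) < \<infinity>"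
  shows "finite_cost b"
  unfolding finite_cost_def
proof (intro conjI allI impI b)
  fix T :: real assume T: "0 < T"
  obtain j where "1 / real (Suc j) < T" using reals_Archimedean[OF T] by (auto simp: inverse_eq_divide)
  moreover have "\<exists>n. 1 / real (Suc j) \<le> b n \<and> b (n - 1) < 1 / real (Suc j)" by (rule cost_finiteD[OF b fin(2)])
  ultimately obtain m where m: "b m < T" by (meson order.strict_trans)
  obtain i :: nat where "T \<le> real i" using real_arch_simple by blast
  then have "T \<le> real (Suc i)" by simp
  moreover have "\<exists>n. real (Suc i) \<le> b n \<and> b (n - 1) < real (Suc i)" by (rule cost_finiteD[OF b fin(1)])
  ultimately obtain n where n: "T \<le> b n" by (meson order.trans)
  from crossing_exists[OF b m n] show "\<exists>n. T \<le> b n \<and> b (n - 1) < T" .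
next
  obtain n where n: "1 \<le> b n" "b (n - 1) < 1" and sum: "bid_sum b 1 < \<infinity>"
    using cost_finiteD[OF b fin(1), of 0] by auto
  have "summable (\<lambda>k. b (n - int k))"
    using sum b unfolding bid_sum_eq[OF b n]
    by (intro summable_suminf_not_top) (auto simp: strategy_def less_imp_le)
  then show "summable (\<lambda>k. b (- int k))" using summable_shift_int[of b n 0] by simp
qed

section \<open>The lower bound\<close>

locale robust_strategy =
  fixes M :: "(int \<Rightarrow> real) measure" and \<rho> :: real
  assumes randomized: "randomized_strategy M" and robust: "robust M \<rho>"
begin

sublocale prob_space M using randomized by (simp add: randomized_strategy_def)

lemma sets_M [measurable_cong]: "sets M = sets (Pi\<^sub>M UNIV (\<lambda>_. borel))"
  using randomized by (simp add: randomized_strategy_def)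

lemma AE_cost_finite:
  assumes "0 < T" shows "AE b in M. cost b T < \<infinity>"
proof -
  \<comment> \<open>A function measurable on the whole space that agrees with \<open>cost\<close> on
    strategies.\<close>
  define c where "c b = (if \<exists>n. T \<le> b n \<and> b (n - 1) < T then bid_sum b T else \<infinity>)" for b
  have [measurable]: "c \<in> borel_measurable M" unfolding c_def by measurable
  have AE: "AE b in M. cost b T = c b"
    using randomized cost_strategy unfolding randomized_strategy_def c_def by fastforce
  have "(\<integral>\<^sup>+ b. c b \<partial>M) = exp_cost M T"
    unfolding exp_cost_def using AE by (intro nn_integral_cong_AE) auto
  also have "\<dots> < \<infinity>" using robust assms unfolding robust_def
    by (metis ennreal_less_top infinity_ennreal_def order.strict_trans1)
  finally have "AE b in M. c b \<noteq> \<infinity>" by (intro nn_integral_noteq_infinite) auto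
  with AE show ?thesis by eventually_elim (simp add: top.not_eq_extremum)
qed

lemma AE_finite_cost: "AE b in M. finite_cost b"
proof -
  have "AE b in M. \<forall>j::nat. cost b (real (Suc j)) < \<infinity>" "AE b in M. \<forall>j::nat. cost b (1 / real (Suc j)) < \<infinity>"
    unfolding AE_all_countable by (intro allI AE_cost_finite; simp)+
  moreover have "AE b in M. strategy b" using randomized by (simp add: randomized_strategy_def)
  ultimately show ?thesis by eventually_elim (auto intro!: finite_costI)
qed

lemma measurable_at_first_bid:
  "(\<lambda>b. sum_below b (first_bid b T)) \<in> borel_measurable M"
  "(\<lambda>b. sum_below b (first_bid b T + 1)) \<in> borel_measurable M"
  "(\<lambda>b. b (first_bid b T)) \<in> borel_measurable M"
  "(\<lambda>b. real_of_int (first_bid b T)) \<in> borel_measurable M"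
  unfolding measurable_cong_sets[OF sets_M refl]
     apply (rule measurable_compose_countable[where f = "\<lambda>i b. sum_below b i", OF sum_below_measurable first_bid_measurable])
    apply (rule measurable_compose_countable[where f = "\<lambda>i b. sum_below b (i + 1)", OF sum_below_measurable first_bid_measurable])
   apply (rule measurable_compose_countable[where f = "\<lambda>i b. b i", OF bid_measurable first_bid_measurable])
  apply (rule measurable_compose_countable[where f = "\<lambda>i b. real_of_int i", OF measurable_const first_bid_measurable])
  apply simp
  done

lemma exp_cost_eq:
  assumes "0 < T"
  shows "exp_cost M T = (\<integral>\<^sup>+ b. ennreal (sum_below b (first_bid b T + 1)) \<partial>M)"
proof -
  have "AE b in M. cost b T = ennreal (sum_below b (first_bid b T + 1))"
    using AE_finite_cost by eventually_elim (rule cost_eq[OF _ assms])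
  then show ?thesis unfolding exp_cost_def by (rule nn_integral_cong_AE)
qed

lemma AE_sum_below_nonneg:
  "AE b in M. 0 \<le> sum_below b (first_bid b T)" "AE b in M. 0 \<le> sum_below b (first_bid b T + 1)"
  using AE_finite_cost by (eventually_elim, simp add: less_imp_le sum_below_pos)+

lemma integrable_cost: "0 < T \<Longrightarrow> integrable M (\<lambda>b. sum_below b (first_bid b T + 1))"
proof (rule integrableI_nonneg)
  assume T: "0 < T"
  show "AE b in M. 0 \<le> sum_below b (first_bid b T + 1)"
    by (rule AE_sum_below_nonneg)
  show "(\<integral>\<^sup>+ b. ennreal (sum_below b (first_bid b T + 1)) \<partial>M) < \<infinity>"
    using robust T unfolding robust_def exp_cost_eq[OF T, symmetric]
    by (metis ennreal_less_top infinity_ennreal_def order.strict_trans1)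
qed (rule measurable_at_first_bid)

section \<open>Expected costs, partial sums and bid counts\<close>

definition mean_cost :: "real \<Rightarrow> real" where
  "mean_cost T = expectation (\<lambda>b. sum_below b (first_bid b T + 1))"

lemma exp_cost_mean_cost: "0 < T \<Longrightarrow> exp_cost M T = ennreal (mean_cost T)"
  unfolding exp_cost_eq mean_cost_def
  by (intro nn_integral_eq_integral integrable_cost AE_sum_below_nonneg)

lemma integrable_sum_below:
  assumes "0 < T"
  shows "integrable M (\<lambda>b. sum_below b (first_bid b T))"
proof (rule Bochner_Integration.integrable_bound[OF integrable_cost[OF assms]])
  show "(\<lambda>b. sum_below b (first_bid b T)) \<in> borel_measurable M" by (rule measurable_at_first_bid)
  show "AE b in M. norm (sum_below b (first_bid b T)) \<le> norm (sum_below b (first_bid b T + 1))"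
    using AE_finite_cost
  proof eventually_elim
    case (elim b)
    then show ?case
      using sum_below_pos[OF elim, of "first_bid b T"] sum_below_step[OF elim] bid_pos[OF elim, of "first_bid b T"]
      by simp
  qed
qed

lemma integrable_bid:
  assumes "0 < T"
  shows "integrable M (\<lambda>b. b (first_bid b T))"
proof (rule Bochner_Integration.integrable_bound[OF integrable_cost[OF assms]])
  show "(\<lambda>b. b (first_bid b T)) \<in> borel_measurable M" by (rule measurable_at_first_bid)
  show "AE b in M. norm (b (first_bid b T)) \<le> norm (sum_below b (first_bid b T + 1))"
    using AE_finite_cost
  proof eventually_elim
    case (elim b)
    then show ?case
      using sum_below_pos[OF elim, of "first_bid b T"] sum_below_step[OF elim] bid_pos[OF elim, of "first_bid b T"]
      by simp
  qed
qed

text \<open>Every bid counted by the difference is at least \<open>\<theta>\<close>, so their number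
  is dominated by the integrable partial sum divided by \<open>\<theta>\<close>.\<close>

lemma integrable_first_bid_diff:
  assumes "0 < \<theta>" "\<theta> \<le> T"
  shows "integrable M (\<lambda>b. real_of_int (first_bid b T - first_bid b \<theta>))"
proof (rule Bochner_Integration.integrable_bound)
  show "integrable M (\<lambda>b. sum_below b (first_bid b T) / \<theta>)"
    using assms by (intro integrable_divide_zero integrable_sum_below) auto
  show "AE b in M. norm (real_of_int (first_bid b T - first_bid b \<theta>)) \<le> norm (sum_below b (first_bid b T) / \<theta>)"
    using AE_finite_cost
  proof eventually_elim
    case (elim b)
    have "\<theta> * real_of_int (first_bid b T - first_bid b \<theta>) \<le> sum_below b (first_bid b T)"
      using sum_below_ge[OF elim assms(1), of "first_bid b T"] sum_below_pos[OF elim, of "first_bid b \<theta>"] by linarith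
    then show ?case using first_bid_mono[OF elim assms] assms sum_below_pos[OF elim, of "first_bid b T"]
      by (simp add: field_simps)
  qed
  show "(\<lambda>b. real_of_int (first_bid b T - first_bid b \<theta>)) \<in> borel_measurable M"
    unfolding of_int_diff by (intro borel_measurable_diff measurable_at_first_bid)
qed

text \<open>The integer labels of the bids carry no meaning and \<open>first_bid\<close> by itself
  may fail to be integrable; anchoring the labels at target 1 removes this freedom.\<close>

definition count :: "(int \<Rightarrow> real) \<Rightarrow> real \<Rightarrow> real" where
  "count b T = real_of_int (first_bid b T - first_bid b 1)"

lemma integrable_count: assumes "0 < T" shows "integrable M (\<lambda>b. count b T)"
proof (cases "1 \<le> T")
  case True then show ?thesis using integrable_first_bid_diff[of 1 T] by (simp add: count_def)
next
  case False
  have "integrable M (\<lambda>b. - real_of_int (first_bid b 1 - first_bid b T))"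
    using False assms by (intro Bochner_Integration.integrable_minus integrable_first_bid_diff) auto
  then show ?thesis by (simp add: count_def)
qed

definition mean_count :: "real \<Rightarrow> real" where "mean_count T = expectation (\<lambda>b. count b T)"
definition mean_below :: "real \<Rightarrow> real" where "mean_below T = expectation (\<lambda>b. sum_below b (first_bid b T))"

lemma mean_count_1: "mean_count 1 = 0" by (simp add: mean_count_def count_def)

lemma mean_count_mono:
  assumes "0 < \<theta>" "\<theta> \<le> T"
  shows "mean_count \<theta> \<le> mean_count T"
proof -
  have "AE b in M. count b \<theta> \<le> count b T"
    using AE_finite_cost by eventually_elim (use first_bid_mono[OF _ assms] in \<open>simp add: count_def\<close>)
  then show ?thesis unfolding mean_count_def
    using assms by (intro integral_mono_AE integrable_count) auto
qed

lemma mean_below_pos: assumes "0 < T" shows "0 < mean_below T"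
proof -
  have "mean_below T \<noteq> 0"
  proof
    assume "mean_below T = 0"
    then have "AE b in M. sum_below b (first_bid b T) = 0"
      using integral_nonneg_eq_0_iff_AE[OF integrable_sum_below[OF assms] AE_sum_below_nonneg(1)]
      by (simp add: mean_below_def)
    then have "AE b in M. False" using AE_finite_cost
      by eventually_elim (metis less_irrefl sum_below_pos)
    then show False by simp
  qed
  moreover have "0 \<le> mean_below T" unfolding mean_below_def
    by (intro integral_nonneg_AE AE_sum_below_nonneg)
  ultimately show ?thesis by simp
qed

lemma mean_below_ge:
  assumes "0 < \<theta>" "0 < T"
  shows "mean_below \<theta> + \<theta> * (mean_count T - mean_count \<theta>) \<le> mean_below T"
proof -
  have "mean_below \<theta> + \<theta> * (mean_count T - mean_count \<theta>)
     = expectation (\<lambda>b. sum_below b (first_bid b \<theta>) + \<theta> * (count b T - count b \<theta>))"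
    unfolding mean_below_def mean_count_def using assms
    by (simp add: integrable_sum_below integrable_count)
  also have "\<dots> \<le> mean_below T"
  proof -
    have "AE b in M. sum_below b (first_bid b \<theta>) + \<theta> * (count b T - count b \<theta>) \<le> sum_below b (first_bid b T)"
      using AE_finite_cost
    proof eventually_elim
      case (elim b)
      show ?case using sum_below_ge[OF elim assms(1), of "first_bid b T"] by (simp add: count_def)
    qed
    then show ?thesis unfolding mean_below_def
      by (intro integral_mono_AE Bochner_Integration.integrable_add integrable_mult_right
          Bochner_Integration.integrable_diff integrable_sum_below integrable_count assms)
  qed
  finally show ?thesis .
qed

text \<open>The expectation of \<open>sum_below_ge\<close> one index later: the cost includes the
  bid at \<open>first_bid b T\<close>, hence the summand 1.\<close>

lemma mean_cost_ge:
  assumes "0 < \<theta>" "0 < T"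
  shows "mean_below \<theta> + \<theta> * (mean_count T + 1 - mean_count \<theta>) \<le> mean_cost T"
proof -
  have "mean_below \<theta> + \<theta> * (mean_count T + 1 - mean_count \<theta>)
     = expectation (\<lambda>b. sum_below b (first_bid b \<theta>) + \<theta> * (count b T + 1 - count b \<theta>))"
    unfolding mean_below_def mean_count_def using assms
    by (simp add: integrable_sum_below integrable_count prob_space)
  also have "\<dots> \<le> mean_cost T"
  proof -
    have "AE b in M. sum_below b (first_bid b \<theta>) + \<theta> * (count b T + 1 - count b \<theta>) \<le> sum_below b (first_bid b T + 1)"
      using AE_finite_cost
    proof eventually_elim
      case (elim b)
      have "count b T + 1 - count b \<theta> = real_of_int (first_bid b T + 1 - first_bid b \<theta>)" by (simp add: count_def)
      then show ?case using sum_below_ge[OF elim assms(1), of "first_bid b T + 1"] by (simp only:)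
    qed
    then show ?thesis unfolding mean_cost_def
      by (intro integral_mono_AE Bochner_Integration.integrable_add integrable_mult_right
          Bochner_Integration.integrable_diff integrable_sum_below integrable_count integrable_cost integrable_const assms)
  qed
  finally show ?thesis .
qed

lemma mean_cost_pos: "0 < T \<Longrightarrow> 0 < mean_cost T"
  using mean_cost_ge[of T T] mean_below_pos[of T] by simp

lemma mean_cost_le: assumes "0 < T" shows "mean_cost T \<le> \<rho> * T"
proof -
  have le: "ennreal (mean_cost T) \<le> ennreal (\<rho> * T)"
    using robust assms by (simp add: robust_def flip: exp_cost_mean_cost)
  \<comment> \<open>A negative right side would become 0 under \<open>ennreal\<close>; positivity of
    the mean cost excludes this.\<close>
  then show ?thesis using mean_cost_pos[OF assms]
    by (cases "0 \<le> \<rho> * T") (auto simp: ennreal_neg)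
qed

lemma rho_pos: "0 < \<rho>" using mean_cost_le[of 1] mean_cost_pos[of 1] by simp

text \<open>Take expectations in \<open>first_bid_gap\<close>: the bid that covers T is part of the
  cost on T, so its mean is at most \<open>\<rho> * T\<close>.\<close>

lemma mean_count_gap:
  assumes "0 < T" "T \<le> R"
  shows "1 - \<rho> * T / R \<le> mean_count R - mean_count T"
proof -
  have "expectation (\<lambda>b. b (first_bid b T)) \<le> mean_cost T"
  proof -
    have "AE b in M. b (first_bid b T) \<le> sum_below b (first_bid b T + 1)"
      using AE_finite_cost by eventually_elim (simp add: sum_below_step less_imp_le sum_below_pos)
    then show ?thesis unfolding mean_cost_def
      by (intro integral_mono_AE integrable_bid integrable_cost assms)
  qed
  also have "\<dots> \<le> \<rho> * T" using assms by (intro mean_cost_le)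
  finally have "1 - \<rho> * T / R \<le> 1 - expectation (\<lambda>b. b (first_bid b T)) / R"
    using assms by (simp add: divide_right_mono)
  also have "\<dots> = expectation (\<lambda>b. 1 - b (first_bid b T) / R)"
    using assms by (simp add: integrable_bid prob_space)
  also have "\<dots> \<le> expectation (\<lambda>b. count b R - count b T)"
  proof -
    have "AE b in M. 1 - b (first_bid b T) / R \<le> count b R - count b T"
      using AE_finite_cost by eventually_elim (use first_bid_gap[OF _ assms] in \<open>simp add: count_def\<close>)
    then show ?thesis
      using assms by (intro integral_mono_AE Bochner_Integration.integrable_diff integrable_const
          integrable_divide_zero integrable_bid integrable_count) auto
  qed
  also have "\<dots> = mean_count R - mean_count T" using assms by (simp add: mean_count_def integrable_count)
  finally show ?thesis .
qed

lemma mean_count_unbounded: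
  shows "\<exists>T\<ge>1. x \<le> mean_count T" and "\<exists>T>0. mean_count T \<le> x"
proof -
  \<comment> \<open>Enlarging a target by the factor \<open>2 * \<rho>\<close> or more raises the
    mean count by at least 1/2; the maximum with 1 ensures that the target does not shrink.\<close>
  define q where "q = max 1 (2 * \<rho>)"
  have q: "1 \<le> q" "2 * \<rho> \<le> q" by (auto simp: q_def)
  have half: "mean_count T + 1 / 2 \<le> mean_count (q * T)" if "0 < T" for T
  proof -
    have "\<rho> * T / (q * T) = \<rho> / q" using that by simp
    also have "\<dots> \<le> 1 / 2" using q by (simp add: field_simps)
    finally have "\<rho> * T / (q * T) \<le> 1 / 2" .
    moreover have "T \<le> q * T" using q that by simp
    ultimately show ?thesis using mean_count_gap[of T "q * T"] that by linarith
  qed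
  have up: "real n / 2 \<le> mean_count (q ^ n)" for n
  proof (induction n)
    case (Suc n) then show ?case using half[of "q ^ n"] q by (simp add: field_simps)
  qed (simp add: mean_count_1)
  have down: "mean_count (1 / q ^ n) \<le> - (real n / 2)" for n
  proof (induction n)
    case (Suc n) then show ?case using half[of "1 / q ^ Suc n"] q by (simp add: field_simps)
  qed (simp add: mean_count_1)
  obtain n :: nat where n: "2 * \<bar>x\<bar> \<le> real n" using real_arch_simple by blast
  show "\<exists>T\<ge>1. x \<le> mean_count T" using up[of n] n q by (intro exI[of _ "q ^ n"]) auto
  show "\<exists>T>0. mean_count T \<le> x" using down[of n] n q by (intro exI[of _ "1 / q ^ n"]) auto
qed

section \<open>The least expected sum as a convex function of the expected count\<close>

text \<open>The Legendre-type formula for the least expected sum of bids of expected number t, counted relative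
  to the target 1; its subgradients are the quantiles of the intensity measure of the bids.\<close>
definition least_sum :: "real \<Rightarrow> real" where
  "least_sum t = (SUP \<theta>\<in>{0<..}. mean_below \<theta> + \<theta> * (t - mean_count \<theta>))"

text \<open>Because the mean count is unbounded, some target T has mean count at least t, and its
  finite mean cost bounds all the affine functions at t.\<close>

lemma least_sum_bdd: "bdd_above ((\<lambda>\<theta>. mean_below \<theta> + \<theta> * (t - mean_count \<theta>)) ` {0<..})"
proof -
  obtain T where T: "1 \<le> T" "t \<le> mean_count T" using mean_count_unbounded by blast
  have "mean_below \<theta> + \<theta> * (t - mean_count \<theta>) \<le> mean_cost T" if "0 < \<theta>" for \<theta>
  proof -
    have "\<theta> * (t - mean_count \<theta>) \<le> \<theta> * (mean_count T + 1 - mean_count \<theta>)" using T that by (intro mult_left_mono) auto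
    then show ?thesis using mean_cost_ge[of \<theta> T] that T by linarith
  qed
  then show ?thesis by (auto simp: bdd_above_def)
qed

lemma least_sum_ge: "0 < \<theta> \<Longrightarrow> mean_below \<theta> + \<theta> * (t - mean_count \<theta>) \<le> least_sum t"
  unfolding least_sum_def by (intro cSUP_upper least_sum_bdd) simp

lemma least_sum_le: "(\<And>\<theta>. 0 < \<theta> \<Longrightarrow> mean_below \<theta> + \<theta> * (t - mean_count \<theta>) \<le> c) \<Longrightarrow> least_sum t \<le> c"
  unfolding least_sum_def by (intro cSUP_least) auto

lemma least_sum_le_mean_cost: "0 < T \<Longrightarrow> least_sum (mean_count T + 1) \<le> mean_cost T"
  by (intro least_sum_le mean_cost_ge)

lemma least_sum_mono: "t \<le> t' \<Longrightarrow> least_sum t \<le> least_sum t'"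
  by (intro least_sum_le order.trans[OF _ least_sum_ge]) auto

lemma least_sum_pos: "0 < least_sum t"
proof -
  obtain T where T: "0 < T" "mean_count T \<le> t" using mean_count_unbounded by blast
  then have "0 \<le> T * (t - mean_count T)" by simp
  then show ?thesis using least_sum_ge[OF T(1), of t] mean_below_pos[OF T(1)] by linarith
qed

lemma least_sum_continuous: "continuous_on UNIV least_sum"
proof (rule convex_on_continuous)
  \<comment> \<open>A finite supremum of functions affine in t is convex, hence continuous on the
    line.\<close>
  show "convex_on UNIV least_sum"
  proof (rule convex_onI)
    fix u x y :: real assume u: "0 < u" "u < 1"
    show "least_sum ((1 - u) *\<^sub>R x + u *\<^sub>R y) \<le> (1 - u) * least_sum x + u * least_sum y"
    proof (rule least_sum_le)
      fix \<theta> :: real assume "0 < \<theta>"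
      have "mean_below \<theta> + \<theta> * ((1 - u) *\<^sub>R x + u *\<^sub>R y - mean_count \<theta>)
        = (1 - u) * (mean_below \<theta> + \<theta> * (x - mean_count \<theta>)) + u * (mean_below \<theta> + \<theta> * (y - mean_count \<theta>))"
        by (simp add: algebra_simps)
      also have "\<dots> \<le> (1 - u) * least_sum x + u * least_sum y"
        using u \<open>0 < \<theta>\<close> by (intro add_mono mult_left_mono least_sum_ge) auto
      finally show "mean_below \<theta> + \<theta> * ((1 - u) *\<^sub>R x + u *\<^sub>R y - mean_count \<theta>)
        \<le> (1 - u) * least_sum x + u * least_sum y" .
    qed
  qed simp
qed simp

text \<open>T is the quantile of \<open>mean_count\<close> at level t. Targets just above T have
  mean count beyond t, so robustness bounds \<open>least_sum (t + 1)\<close>; slopes just below T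
  have mean count at most t and bound the increments of \<open>least_sum\<close>. Both bounds pass
  to the limit T, where the mean count may jump.\<close>

lemma least_sum_subgradient:
  obtains T where "0 < T" "least_sum (t + 1) \<le> \<rho> * T"
    "\<And>t'. t \<le> t' \<Longrightarrow> T * (t' - t) \<le> least_sum t' - least_sum t" "0 \<le> t \<Longrightarrow> 1 \<le> T"
proof -
  define A where "A = {\<theta>. 0 < \<theta> \<and> mean_count \<theta> \<le> t}"
  define T where "T = Sup A"
  obtain \<theta>0 where \<theta>0: "\<theta>0 \<in> A" using mean_count_unbounded(2)[of t] by (auto simp: A_def)
  obtain B where B: "1 \<le> B" "t + 1 \<le> mean_count B" using mean_count_unbounded(1) by blast
  have bdd: "bdd_above A"
  proof (rule bdd_aboveI)
    fix \<theta> assume "\<theta> \<in> A"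
    then show "\<theta> \<le> B" using B mean_count_mono[of B \<theta>] by (force simp: A_def)
  qed
  have Tpos: "0 < T" using cSup_upper[OF \<theta>0 bdd] \<theta>0 by (simp add: T_def A_def)
  have above: "least_sum (t + 1) \<le> \<rho> * T'" if "T < T'" for T'
  proof -
    have "T' \<notin> A" using cSup_upper[OF _ bdd, of T'] that by (auto simp: T_def)
    then have "t < mean_count T'" using that Tpos by (auto simp: A_def)
    then have "least_sum (t + 1) \<le> least_sum (mean_count T' + 1)" by (intro least_sum_mono) auto
    also have "\<dots> \<le> mean_cost T'" using that Tpos by (intro least_sum_le_mean_cost) auto
    also have "\<dots> \<le> \<rho> * T'" using that Tpos by (intro mean_cost_le) auto
    finally show ?thesis .
  qed
  have 1: "least_sum (t + 1) \<le> \<rho> * T"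
  proof -
    have "least_sum (t + 1) / \<rho> \<le> T'" if "T < T'" for T'
      using above[OF that] rho_pos by (simp add: field_simps)
    then have "least_sum (t + 1) / \<rho> \<le> T" by (rule dense_ge)
    then show ?thesis using rho_pos by (simp add: field_simps)
  qed
  have below: "\<theta> * (t' - t) \<le> least_sum t' - least_sum t" if \<theta>: "0 < \<theta>" "\<theta> < T" and t: "t \<le> t'" for \<theta> t'
  proof -
    obtain \<theta>1 where \<theta>1: "\<theta>1 \<in> A" "\<theta> < \<theta>1" using less_cSupD[of A \<theta>] \<theta> \<theta>0 by (auto simp: T_def)
    then have count: "mean_count \<theta> \<le> t" using mean_count_mono[of \<theta> \<theta>1] \<theta> by (auto simp: A_def)
    have "least_sum t \<le> least_sum t' - \<theta> * (t' - t)"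
    proof (rule least_sum_le)
      fix \<eta> :: real assume \<eta>: "0 < \<eta>"
      \<comment> \<open>Since \<open>mean_count \<theta> \<le> t\<close>, raising a slope below
        \<open>\<theta>\<close> to \<open>\<theta>\<close> does not lower the affine value at t; the
        line of slope \<open>\<zeta>\<close> then rises by at least
        \<open>\<theta> * (t' - t)\<close>.\<close>
      define \<zeta> where "\<zeta> = max \<eta> \<theta>"
      have le: "mean_below \<eta> + \<eta> * (t - mean_count \<eta>) \<le> mean_below \<zeta> + \<zeta> * (t - mean_count \<zeta>)"
      proof (cases "\<eta> \<le> \<theta>")
        case True
        have "\<eta> * (t - mean_count \<theta>) \<le> \<theta> * (t - mean_count \<theta>)"
          using True count by (intro mult_right_mono) auto
        then show ?thesis
          using mean_below_ge[OF \<eta> \<theta>(1)] True by (simp add: \<zeta>_def algebra_simps max_def)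
      qed (simp add: \<zeta>_def)
      have "\<theta> * (t' - t) \<le> \<zeta> * (t' - t)" using t by (intro mult_right_mono) (auto simp: \<zeta>_def)
      moreover have "mean_below \<zeta> + \<zeta> * (t' - mean_count \<zeta>) \<le> least_sum t'"
        using \<theta> by (intro least_sum_ge) (simp add: \<zeta>_def)
      ultimately show "mean_below \<eta> + \<eta> * (t - mean_count \<eta>) \<le> least_sum t' - \<theta> * (t' - t)"
        using le by (simp add: algebra_simps)
    qed
    then show ?thesis by simp
  qed
  have 2: "T * (t' - t) \<le> least_sum t' - least_sum t" if t: "t \<le> t'" for t'
  proof (cases "t = t'")
    case False
    then have "\<theta> \<le> (least_sum t' - least_sum t) / (t' - t)" if "0 < \<theta>" "\<theta> < T" for \<theta>
      using below[OF that t] t by (simp add: field_simps)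
    then have "T \<le> (least_sum t' - least_sum t) / (t' - t)"
      by (rule dense_le_bounded[OF Tpos])
    then show ?thesis using False t by (simp add: field_simps)
  qed simp
  \<comment> \<open>Target 1 has mean count 0, so it belongs to A.\<close>
  have 3: "1 \<le> T" if "0 \<le> t"
    using cSup_upper[OF _ bdd, of 1] that by (simp add: T_def A_def mean_count_1)
  show thesis using that[OF Tpos 1 2 3] .
qed

lemma mean_cost_one_gt:
  assumes s: "0 < s" "s \<le> 1" and \<rho>: "\<rho> < exp s / s" and p: "0 \<le> p" "p \<le> 1"
  shows "exp s * (1 - exp (- s * p)) / s < mean_cost 1 * (1 - s * (1 - p))"
proof -
  interpret advance_growth least_sum s "1 / \<rho>"
  proof
    show "s * exp (- s) < 1 / \<rho>" using s \<rho> rho_pos by (simp add: exp_minus field_simps)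
    show "(t' - t) * (1 / \<rho> * least_sum (t + 1)) \<le> least_sum t' - least_sum t" if t: "t \<le> t'" for t t'
    proof -
      obtain T where T: "least_sum (t + 1) \<le> \<rho> * T" "T * (t' - t) \<le> least_sum t' - least_sum t"
        using least_sum_subgradient[of t] t by metis
      have "(t' - t) * (1 / \<rho> * least_sum (t + 1)) \<le> (t' - t) * T"
        using T(1) t rho_pos by (intro mult_left_mono) (auto simp: field_simps)
      then show ?thesis using T(2) by (simp add: mult.commute)
    qed
  qed (use s least_sum_pos least_sum_continuous in auto)
  have "exp s * (1 - exp (- s * p)) / s < least_sum 1 * (1 - s * (1 - p))"
  proof (rule value_at_one_gt[OF _ p])
    fix t t' :: real assume t: "0 \<le> t" "t \<le> t'"
    obtain T where T: "T * (t' - t) \<le> least_sum t' - least_sum t" "1 \<le> T"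
      using least_sum_subgradient[of t] t by metis
    have "1 * (t' - t) \<le> T * (t' - t)" using T(2) t by (intro mult_right_mono) auto
    then show "t' - t \<le> least_sum t' - least_sum t" using T(1) by simp
  qed
  also have "\<dots> \<le> mean_cost 1 * (1 - s * (1 - p))"
  proof (rule mult_right_mono)
    show "least_sum 1 \<le> mean_cost 1" using least_sum_le_mean_cost[of 1] by (simp add: mean_count_1)
    have "s * (1 - p) \<le> 1 * 1" using s p by (intro mult_mono) auto
    then show "0 \<le> 1 - s * (1 - p)" by simp
  qed
  finally show ?thesis .
qed

end

section \<open>The optimal bidding curve\<close>

text \<open>Here p is the kink of the bidding curve and y the height from which the curve jumps to 1.
  For \<open>s < ln 2\<close> the kink is at 1, otherwise it comes from \<open>xi s = exp (s * (1 - p))\<close>.\<close>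
lemma curve_parameters:
  fixes s :: real
  assumes s: "0 < s" "s \<le> 1"
  obtains p y where "0 \<le> p" "p \<le> 1"
    "y = 1 - exp (- s * p) + s * (1 - p) * exp (- s * p)"
    "y \<le> exp (- s * p)" "(1 - p) * y = (1 - p) * exp (- s * p)"
    "chi s = exp s * y / s"
proof (cases "s < ln 2")
  case True
  then have "exp s < 2" by (metis exp_less_cancel_iff exp_ln zero_less_numeral)
  then have "1 - exp (- s) \<le> exp (- s)" by (simp add: exp_minus field_simps)
  moreover have "chi s = exp s * (1 - exp (- s)) / s" using True by (simp add: chi_def right_diff_distrib mult_exp_exp)
  \<comment> \<open>With \<open>p = 1\<close> the complementarity condition is trivial, and the
    inequality for y amounts to \<open>exp s <= 2\<close>.\<close>
  ultimately show thesis using that[of 1 "1 - exp (- s)"] by simp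
next
  case False
  define g where "g x = x * (2 - ln x)" for x :: real
  have cont: "continuous_on {1..exp s} g" unfolding g_def by (intro continuous_intros) auto
  have "2 \<le> exp s" using False by (metis exp_le_cancel_iff exp_ln not_less zero_less_numeral)
  then have "g 1 \<le> exp s" by (simp add: g_def)
  moreover have "exp s \<le> g (exp s)" using s by (simp add: g_def)
  ultimately obtain x where x: "1 \<le> x" "x \<le> exp s" "g x = exp s"
    using IVT'[OF _ _ _ cont] s by auto
  have xe: "x \<le> exp 1" using x s by (meson exp_le_cancel_iff order.trans)
  \<comment> \<open>The derivative \<open>1 - ln w\<close> is positive below \<open>exp 1\<close>,
    which gives the uniqueness that evaluates the description in \<open>xi\<close>.\<close>
  have g_strict: "g u < g v" if "1 \<le> u" "u < v" "v \<le> exp 1" for u v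
  proof (rule DERIV_pos_imp_increasing_open[OF that(2)])
    fix w assume w: "u < w" "w < v"
    have "(g has_real_derivative (1 - ln w)) (at w)"
      unfolding g_def using w that by (auto intro!: derivative_eq_intros simp: field_simps)
    moreover have "ln w < 1" using w that by (metis dual_order.strict_trans1 exp_gt_zero ln_exp ln_less_cancel_iff order.strict_trans1 order.strict_trans zero_less_one)
    ultimately show "\<exists>y. (g has_real_derivative y) (at w) \<and> 0 < y" by (intro exI[of _ "1 - ln w"]) auto
  next
    show "continuous_on {u..v} g" unfolding g_def using that by (intro continuous_intros) auto
  qed
  have "xi s = x" unfolding xi_def
  proof (rule the_equality)
    show "1 \<le> x \<and> x \<le> exp 1 \<and> x * (2 - ln x) = exp s" using x xe by (simp add: g_def)
    fix z assume z: "1 \<le> z \<and> z \<le> exp 1 \<and> z * (2 - ln z) = exp s"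
    then show "z = x" using g_strict[of z x] g_strict[of x z] x xe by (cases z x rule: linorder_cases) (auto simp: g_def)
  qed
  then have chi: "chi s = x / s" using False by (simp add: chi_def)
  define p where "p = 1 - ln x / s"
  have sp: "s * (1 - p) = ln x" "- s * p = ln x - s" using s by (simp_all add: p_def field_simps)
  have y: "exp (- s * p) = x * exp (- s)" unfolding sp using x by (simp add: exp_diff exp_minus field_simps)
  have "ln x \<le> s" using x s by (metis exp_gt_zero ln_exp ln_le_cancel_iff order.strict_trans1 zero_less_one order.strict_trans2)
  then have p: "0 \<le> p" "p \<le> 1" using x s by (auto simp: p_def field_simps)
  have "x * exp (- s) * (2 - ln x) = 1" using x(3) by (simp add: g_def exp_minus field_simps)
  \<comment> \<open>The equation for x says precisely that the height y equals
    \<open>exp (- s * p)\<close>: in this range of s the inequality for y is tight.\<close>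
  then have balance: "x * exp (- s) = 1 - x * exp (- s) + ln x * (x * exp (- s))" by (simp add: algebra_simps)
  show thesis
  proof (rule that[of p "x * exp (- s)", OF p])
    show "x * exp (- s) = 1 - exp (- s * p) + s * (1 - p) * exp (- s * p)"
      unfolding y sp(1) by (rule balance)
    show "chi s = exp s * (x * exp (- s)) / s" unfolding chi by (simp add: exp_minus)
  qed (simp_all only: y order_refl)
qed

text \<open>\<open>y_eq\<close> fixes the height at 0 from the left by the vanishing of the
  component along \<open>exp (s * t)\<close>; \<open>y_le\<close> is what robustness beyond the kink
  requires.\<close>

locale bidding_curve =
  fixes s p y :: real
  assumes s: "0 < s" "s \<le> 1" and p: "0 \<le> p" "p \<le> 1"
    and y_eq: "y = 1 - exp (- s * p) + s * (1 - p) * exp (- s * p)"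
    and y_le: "y \<le> exp (- s * p)"
begin

section \<open>Backward construction of the unit pieces\<close>

abbreviation \<rho> :: real where "\<rho> \<equiv> exp s / s"

text \<open>The piece F k is the curve on the unit interval starting at -k. Its value at 1 is chosen
  so that the component of the curve along exp (s t) vanishes.\<close>
primrec F :: "nat \<Rightarrow> real \<Rightarrow> real" where
  "F 0 = (\<lambda>u. exp (s * max 0 (u - p)))"
| "F (Suc k) = (\<lambda>u. s * integral {0..1} (\<lambda>v. exp (- s * v) * F k v) - integral {u..1} (F k) / \<rho>)"

declare F.simps [simp del]

text \<open>Continuity appears as a premise because it is proved afterwards by induction, through
  the derivative of the next piece.\<close>

lemma F_Suc_if_continuous:
  assumes "continuous_on {0..1} (F k)" "u \<in> {0..1}"
  shows "F (Suc k) u = F (Suc k) 0 + integral {0..u} (F k) / \<rho>"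
proof -
  have "integral {0..1} (F k) = integral {0..u} (F k) + integral {u..1} (F k)"
    using assms by (intro Henstock_Kurzweil_Integration.integral_combine[symmetric] integrable_continuous_interval) auto
  then show ?thesis by (simp add: F.simps(2) field_simps)
qed

lemma F_Suc_derivative_if_continuous:
  assumes "continuous_on {0..1} (F k)" "u \<in> {0..1}"
  shows "(F (Suc k) has_real_derivative F k u / \<rho>) (at u within {0..1})"
proof -
  have "((\<lambda>u. integral {0..u} (F k)) has_real_derivative F k u) (at u within {0..1})"
    unfolding has_real_derivative_iff_has_vector_derivative
    using assms by (rule integral_has_vector_derivative)
  then have "((\<lambda>u. F (Suc k) 0 + integral {0..u} (F k) / \<rho>) has_real_derivative 0 + F k u / \<rho>) (at u within {0..1})"
    by (intro DERIV_add DERIV_cdivide) auto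
  then have "((\<lambda>u. F (Suc k) 0 + integral {0..u} (F k) / \<rho>) has_real_derivative F k u / \<rho>) (at u within {0..1})"
    by simp
  then show ?thesis
    by (rule has_field_derivative_transform_within[OF _ zero_less_one assms(2)])
      (rule F_Suc_if_continuous[OF assms(1), symmetric])
qed

lemma F_continuous: "continuous_on {0..1} (F k)"
proof (induction k)
  case 0 show ?case by (auto simp: F.simps(1) intro!: continuous_intros)
next
  case (Suc k)
  show ?case using F_Suc_derivative_if_continuous[OF Suc] by (rule DERIV_continuous_on)
qed

lemmas F_Suc = F_Suc_if_continuous[OF F_continuous]
lemmas F_Suc_derivative = F_Suc_derivative_if_continuous[OF F_continuous]

lemma F_integrable: "0 \<le> a \<Longrightarrow> b \<le> 1 \<Longrightarrow> F k integrable_on {a..b}"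
  by (intro integrable_continuous_interval continuous_on_subset[OF F_continuous]) auto

text \<open>The value of the next piece at 0 is the integral of F k against the weight
  \<open>s * exp (- s * v) - 1 / \<rho>\<close>, which is nonnegative on the unit interval. As F k
  is at least \<open>F k 0\<close>, positivity reduces to that of the total weight
  \<open>1 - exp (- s) - s * exp (- s)\<close>.\<close>

lemma F_pos_mono:
  "(\<forall>u\<in>{0..1}. 0 < F k u) \<and> (\<forall>u v. 0 \<le> u \<longrightarrow> u \<le> v \<longrightarrow> v \<le> 1 \<longrightarrow> F k u \<le> F k v)"
proof (induction k)
  case 0
  show ?case using s by (auto simp: F.simps(1) intro!: mult_left_mono)
next
  case (Suc k)
  have incr: "F (Suc k) u \<le> F (Suc k) v" if "0 \<le> u" "u \<le> v" "v \<le> 1" for u v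
  proof -
    have "integral {0..v} (F k) = integral {0..u} (F k) + integral {u..v} (F k)"
      using that by (intro Henstock_Kurzweil_Integration.integral_combine[symmetric] F_integrable) auto
    moreover have "0 \<le> integral {u..v} (F k)"
      using Suc that by (intro integral_nonneg F_integrable) (auto intro: less_imp_le)
    ultimately have "integral {0..u} (F k) / \<rho> \<le> integral {0..v} (F k) / \<rho>"
      using s by (intro divide_right_mono) auto
    then show ?thesis using F_Suc[of u] F_Suc[of v] that by simp
  qed
  have "0 < F (Suc k) 0"
  proof -
    have "integral {0..1} (\<lambda>v. F k 0 * (s * exp (- s * v)) - F k 0 / \<rho>)
        \<le> integral {0..1} (\<lambda>v. s * exp (- s * v) * F k v - F k v / \<rho>)"
    proof (intro integral_le integrable_continuous_interval continuous_intros F_continuous)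
      fix v :: real assume v: "v \<in> {0..1}"
      then have "s * exp (- s) \<le> s * exp (- s * v)" using s by (auto intro: mult_left_le)
      then have "0 \<le> s * exp (- s * v) - 1 / \<rho>" by (simp add: exp_minus field_simps)
      moreover have "F k 0 \<le> F k v" using Suc v by auto
      ultimately have "(s * exp (- s * v) - 1 / \<rho>) * F k 0 \<le> (s * exp (- s * v) - 1 / \<rho>) * F k v"
        by (intro mult_left_mono)
      then show "F k 0 * (s * exp (- s * v)) - F k 0 / \<rho> \<le> s * exp (- s * v) * F k v - F k v / \<rho>"
        by (simp add: algebra_simps)
    qed (use s in auto)
    also have "\<dots> = F (Suc k) 0"
    proof -
      have "integral {0..1} (\<lambda>v. s * exp (- s * v) * F k v - F k v / \<rho>)
        = integral {0..1} (\<lambda>v. s * exp (- s * v) * F k v) - integral {0..1} (\<lambda>v. F k v / \<rho>)"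
        using s by (intro Henstock_Kurzweil_Integration.integral_diff integrable_continuous_interval continuous_intros F_continuous) auto
      then show ?thesis by (simp add: F.simps(2) mult.assoc)
    qed
    finally have le: "integral {0..1} (\<lambda>v. F k 0 * (s * exp (- s * v)) - F k 0 / \<rho>) \<le> F (Suc k) 0" .
    have "integral {0..1} (\<lambda>v. F k 0 * (s * exp (- s * v)) - F k 0 / \<rho>)
      = integral {0..1} (\<lambda>v. F k 0 * (s * exp (- s * v))) - integral {0..1::real} (\<lambda>v. F k 0 / \<rho>)"
      using s by (intro Henstock_Kurzweil_Integration.integral_diff integrable_continuous_interval continuous_intros) auto
    also have "\<dots> = F k 0 * (1 - exp (- s) - s * exp (- s))"
    proof -
      have "integral {0..1} (\<lambda>v. F k 0 * (s * exp (- s * v))) = F k 0 * (1 - exp (- s))"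
        using integral_exp_neg[of 0 1 s] by simp
      moreover have "F k 0 / \<rho> = F k 0 * (s * exp (- s))" by (simp add: exp_minus field_simps)
      ultimately show ?thesis by (simp add: right_diff_distrib)
    qed
    finally have eq: "integral {0..1} (\<lambda>v. F k 0 * (s * exp (- s * v)) - F k 0 / \<rho>)
      = F k 0 * (1 - exp (- s) - s * exp (- s))" .
    have "1 + s < exp s" using s exp_minus_greater[of "- s"] by simp
    then have "exp (- s) * (1 + s) < exp (- s) * exp s" by (intro mult_strict_left_mono) auto
    then have "0 < 1 - exp (- s) - s * exp (- s)" by (simp add: mult_exp_exp algebra_simps)
    then have "0 < F k 0 * (1 - exp (- s) - s * exp (- s))" using Suc by (intro mult_pos_pos) auto
    then show ?thesis using le eq by simp
  qed
  then show ?case using incr by (metis atLeastAtMost_iff order.strict_trans2 order_refl)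
qed

lemma F_pos: "u \<in> {0..1} \<Longrightarrow> 0 < F k u" using F_pos_mono by blast

lemma F_mono: "0 \<le> u \<Longrightarrow> u \<le> v \<Longrightarrow> v \<le> 1 \<Longrightarrow> F k u \<le> F k v" using F_pos_mono by blast

lemma F_integral: "u \<in> {0..1} \<Longrightarrow> integral {0..u} (F k) = \<rho> * (F (Suc k) u - F (Suc k) 0)"
  using F_Suc[of u k] s by (simp add: field_simps)

lemma F_integral_tail: "u \<in> {0..1} \<Longrightarrow> integral {u..1} (F k) = \<rho> * (F (Suc k) 1 - F (Suc k) u)"
  using s by (simp add: F.simps(2) field_simps)

lemma F_strict_mono: assumes "0 \<le> u" "u < v" "v \<le> 1" shows "F (Suc k) u < F (Suc k) v"
proof -
  have "integral {u..v} (\<lambda>_. F k u) \<le> integral {u..v} (F k)"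
    using assms by (intro integral_le F_integrable) (auto intro: F_mono)
  then have "(v - u) * F k u \<le> integral {u..v} (F k)" using assms by simp
  moreover have "0 < (v - u) * F k u" using assms F_pos[of u k] by simp
  moreover have "integral {0..v} (F k) = integral {0..u} (F k) + integral {u..v} (F k)"
    using assms by (intro Henstock_Kurzweil_Integration.integral_combine[symmetric] F_integrable) auto
  ultimately have "integral {0..u} (F k) / \<rho> < integral {0..v} (F k) / \<rho>"
    using s by (intro divide_strict_right_mono) auto
  then show ?thesis using F_Suc[of u] F_Suc[of v] assms by simp
qed

text \<open>Integrate the derivative of \<open>exp (- s * v) * F (Suc k) v\<close> over the unit
  interval. By the choice of the values at 1, the two resulting integrals are
  \<open>exp (- s) * F (Suc k) 1\<close> and \<open>F (Suc (Suc k)) 1\<close>.\<close>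

lemma F_glue: "F (Suc (Suc k)) 1 = F (Suc k) 0"
proof -
  have "((\<lambda>v. exp (- s * v) * (F k v / \<rho>) - s * exp (- s * v) * F (Suc k) v) has_integral
      exp (- s * 1) * F (Suc k) 1 - exp (- s * 0) * F (Suc k) 0) {0..1}"
    by (intro fundamental_theorem_of_calculus)
      (auto simp flip: has_real_derivative_iff_has_vector_derivative
        intro!: derivative_eq_intros F_Suc_derivative)
  then have "exp (- s) * F (Suc k) 1 - F (Suc k) 0
    = integral {0..1} (\<lambda>v. exp (- s * v) * (F k v / \<rho>) - s * exp (- s * v) * F (Suc k) v)"
    by (simp add: integral_unique)
  also have "\<dots> = integral {0..1} (\<lambda>v. exp (- s * v) * (F k v / \<rho>)) - integral {0..1} (\<lambda>v. s * exp (- s * v) * F (Suc k) v)"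
    using s by (intro Henstock_Kurzweil_Integration.integral_diff integrable_continuous_interval continuous_intros F_continuous) auto
  also have "integral {0..1} (\<lambda>v. s * exp (- s * v) * F (Suc k) v) = F (Suc (Suc k)) 1"
    by (simp add: F.simps(2)[of "Suc k"] mult.assoc)
  also have "integral {0..1} (\<lambda>v. exp (- s * v) * (F k v / \<rho>)) = exp (- s) * F (Suc k) 1"
  proof -
    have "integral {0..1} (\<lambda>v. exp (- s * v) * (F k v / \<rho>)) = integral {0..1} (\<lambda>v. exp (- s * v) * F k v) / \<rho>"
      by (simp only: times_divide_eq_right integral_divide)
    then show ?thesis using s by (simp add: F.simps(2) exp_minus field_simps)
  qed
  finally show ?thesis by simp
qed

text \<open>Beyond p the weight cancels the exponential branch of \<open>F 0\<close>; the two parts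
  add up to the formula in \<open>y_eq\<close>.\<close>

lemma F_1_1: "F 1 1 = y"
proof -
  have int: "(\<lambda>v. exp (- s * v) * F 0 v) integrable_on {a..b}" if "0 \<le> a" "b \<le> 1" for a b
    using that by (auto simp: F.simps(1) intro!: integrable_continuous_interval continuous_intros)
  have "integral {0..1} (\<lambda>v. exp (- s * v) * F 0 v) = integral {0..p} (\<lambda>v. exp (- s * v) * F 0 v)
     + integral {p..1} (\<lambda>v. exp (- s * v) * F 0 v)"
    using p by (intro Henstock_Kurzweil_Integration.integral_combine[symmetric] int) auto
  also have "integral {0..p} (\<lambda>v. exp (- s * v) * F 0 v) = integral {0..p} (\<lambda>v. exp (- s * v))"
    by (intro Henstock_Kurzweil_Integration.integral_cong) (auto simp: F.simps(1))
  also have "\<dots> = (1 - exp (- s * p)) / s"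
    using integral_exp_neg[OF p(1), of s] s by (simp add: field_simps)
  also have "integral {p..1} (\<lambda>v. exp (- s * v) * F 0 v) = integral {p..1} (\<lambda>_. exp (- s * p))"
    by (intro Henstock_Kurzweil_Integration.integral_cong) (auto simp: F.simps(1) mult_exp_exp algebra_simps)
  finally show ?thesis using s p by (simp add: F.simps(2) y_eq field_simps)
qed

lemma y_le_1: "y \<le> 1"
proof -
  have "exp (- s * p) \<le> 1" using s p by simp
  then show ?thesis using y_le by linarith
qed

lemma F_le_below: "F (Suc (k + j)) 1 \<le> F k 0"
proof (induction j)
  case 0
  show ?case
  proof (cases k)
    case 0 then show ?thesis using F_1_1 y_le_1 p by (simp add: F.simps(1))
  next
    case (Suc k') then show ?thesis using F_glue[of k'] by simp
  qed
next
  case (Suc j)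
  have "F (Suc (k + Suc j)) 1 = F (Suc (k + j)) 0" using F_glue by simp
  also have "\<dots> \<le> F (Suc (k + j)) 1" by (rule F_mono) auto
  finally show ?case using Suc by simp
qed

section \<open>The assembled curve: monotonicity and integrals\<close>

definition \<beta> :: "real \<Rightarrow> real" where
  "\<beta> t = (if 0 \<le> t then exp (s * max 0 (t - p)) else F (nat (- \<lfloor>t\<rfloor>)) (frac t))"

lemma \<beta>_piece: assumes "0 \<le> u" "u < 1" shows "\<beta> (u - real k) = F k u"
proof (cases k)
  case 0 then show ?thesis using assms by (simp add: \<beta>_def F.simps(1))
next
  case (Suc j)
  have fl: "\<lfloor>u - real k\<rfloor> = - int k" using assms by (simp add: floor_unique)
  then have "frac (u - real k) = u" by (simp add: frac_def)
  then show ?thesis using assms Suc fl by (simp add: \<beta>_def nat_add_distrib)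
qed

lemma \<beta>_nonneg_arg: "0 \<le> t \<Longrightarrow> \<beta> t = exp (s * max 0 (t - p))" by (simp add: \<beta>_def)

lemma negative_cases:
  assumes "t < 0"
  obtains k u where "0 \<le> u" "u < 1" "t = u - real (Suc k)"
proof -
  have "frac t = t - \<lfloor>t\<rfloor>" "\<lfloor>t\<rfloor> < 0" using assms by (auto simp: frac_def)
  then have "t = frac t - real (Suc (nat (- \<lfloor>t\<rfloor> - 1)))" by (simp add: of_nat_nat)
  then show thesis using that frac_ge_0 frac_lt_1 by blast
qed

lemma \<beta>_pos: "0 < \<beta> t"
proof (cases "t < 0")
  case True
  then obtain k u where "0 \<le> u" "u < 1" "t = u - real (Suc k)" by (rule negative_cases)
  then show ?thesis using \<beta>_piece F_pos by (simp del: of_nat_Suc)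
qed (simp add: \<beta>_def)

lemma \<beta>_neg_less: assumes "t < 0" shows "\<beta> t < y" "\<beta> t < 1"
proof -
  obtain k u where t: "0 \<le> u" "u < 1" "t = u - real (Suc k)" using assms by (rule negative_cases)
  have "\<beta> t = F (Suc k) u" using t \<beta>_piece[of u "Suc k"] by simp
  also have "\<dots> < F (Suc k) 1" using t by (intro F_strict_mono) auto
  also have "\<dots> \<le> y"
  proof (cases k)
    case 0 then show ?thesis using F_1_1 by simp
  next
    case (Suc j)
    have "F (Suc (Suc j)) 1 \<le> F 1 0" using F_le_below[of 1 j] by simp
    also have "\<dots> \<le> F 1 1" by (rule F_mono) auto
    finally show ?thesis using F_1_1 Suc by simp
  qed
  finally show "\<beta> t < y" .
  then show "\<beta> t < 1" using y_le_1 by simp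
qed

lemma \<beta>_mono: "mono \<beta>"
proof (rule monoI)
  fix t t' :: real assume tt: "t \<le> t'"
  consider "0 \<le> t" | "t < 0" "0 \<le> t'" | "t' < 0" by linarith
  then show "\<beta> t \<le> \<beta> t'"
  proof cases
    case 1 then show ?thesis using tt s by (auto simp: \<beta>_def intro!: mult_left_mono)
  next
    case 2
    have "1 \<le> \<beta> t'" using 2 s by (simp add: \<beta>_def)
    then show ?thesis using \<beta>_neg_less[OF 2(1)] by simp
  next
    case 3
    then obtain k' v where t': "0 \<le> v" "v < 1" "t' = v - real (Suc k')" by (rule negative_cases)
    have "t < 0" using 3 tt by simp
    then obtain k u where t: "0 \<le> u" "u < 1" "t = u - real (Suc k)" by (rule negative_cases)
    have eqs: "\<beta> t = F (Suc k) u" "\<beta> t' = F (Suc k') v" using t t' \<beta>_piece[of u "Suc k"] \<beta>_piece[of v "Suc k'"] by auto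
    have "k' \<le> k" using t t' tt by simp
    then consider "k' = k" | j where "k = Suc (k' + j)" using less_imp_Suc_add le_neq_implies_less by blast
    then show ?thesis
    proof cases
      case 1 then show ?thesis using t t' tt unfolding eqs by (auto intro!: F_mono)
    next
      case (2 j)
      have "F (Suc k) u \<le> F (Suc k) 1" using t by (intro F_mono) auto
      also have "\<dots> \<le> F (Suc k') 0" using F_le_below[of "Suc k'" j] 2 by simp
      also have "\<dots> \<le> F (Suc k') v" using t' by (intro F_mono) auto
      finally show ?thesis unfolding eqs .
    qed
  qed
qed

text \<open>The curve is constant on \<open>[0, p]\<close>, so strictness is available only across
  unit shifts; \<open>0 < u\<close> and \<open>p <= 1\<close> place the shifted point beyond the
  kink when n is nonnegative.\<close>

lemma \<beta>_strict: assumes "0 < u" "u < 1" shows "\<beta> (of_int n + u) < \<beta> (of_int n + u + 1)"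
proof -
  consider "n \<le> - 2" | "n = - 1" | "0 \<le> n" by linarith
  then show ?thesis
  proof cases
    case 1
    define k where "k = nat (- n - 2)"
    have n: "of_int n = - real (Suc (Suc k))" using 1 by (simp add: k_def)
    have "\<beta> (of_int n + u) = F (Suc (Suc k)) u" "\<beta> (of_int n + u + 1) = F (Suc k) u"
      using \<beta>_piece[of u "Suc (Suc k)"] \<beta>_piece[of u "Suc k"] assms by (simp_all add: n algebra_simps)
    moreover have "F (Suc (Suc k)) u \<le> F (Suc (Suc k)) 1" using assms by (intro F_mono) auto
    moreover have "F (Suc k) 0 < F (Suc k) u" using assms by (intro F_strict_mono) auto
    ultimately show ?thesis using F_glue[of k] by simp
  next
    case 2
    have "1 \<le> \<beta> (of_int n + u + 1)" using assms s by (simp add: 2 \<beta>_def)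
    moreover have "\<beta> (of_int n + u) < 1" using assms by (intro \<beta>_neg_less) (simp add: 2)
    ultimately show ?thesis by simp
  next
    case 3
    then have "0 \<le> (of_int n :: real)" by simp
    then have "max 0 (of_int n + u - p) < max 0 (of_int n + u + 1 - p)" using assms p by (auto simp: max_def)
    then show ?thesis using 3 assms s by (simp add: \<beta>_def)
  qed
qed

text \<open>The advance equation in integrated form. The interval meets two consecutive pieces, and
  \<open>F_glue\<close> cancels their values at the junction.\<close>

lemma \<beta>_unit_integral:
  assumes "t < 0"
  shows "(\<beta> has_integral \<rho> * (\<beta> t - \<beta> (t - 1))) {t..t+1}"
proof -
  obtain k u where t: "0 \<le> u" "u < 1" "t = u - real (Suc k)" using assms by (rule negative_cases)
  have "(\<beta> has_integral integral {u..1} (F (Suc k))) {t..- real k}"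
  \<comment> \<open>The junction point already belongs to the following piece, and at 0 the curve
    may jump there.\<close>
  proof (rule has_integral_spike_finite[where S = "{- real k}"])
    show "((\<lambda>x. F (Suc k) (x + real (Suc k))) has_integral integral {u..1} (F (Suc k))) {t..- real k}"
      using has_integral_shift_real_ivl[OF integrable_integral[OF F_integrable[of u 1 "Suc k"]], of "real (Suc k)"] t
      by simp
    fix x assume "x \<in> {t..- real k} - {- real k}"
    then show "\<beta> x = F (Suc k) (x + real (Suc k))"
      using \<beta>_piece[of "x + real (Suc k)" "Suc k"] t by simp
  qed simp
  moreover have "(\<beta> has_integral integral {0..u} (F k)) {- real k..t+1}"
  proof (rule has_integral_eq)
    show "((\<lambda>x. F k (x + real k)) has_integral integral {0..u} (F k)) {- real k..t+1}"
      using has_integral_shift_real_ivl[OF integrable_integral[OF F_integrable[of 0 u k]], of "real k"] t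
      by simp
    fix x assume "x \<in> {- real k..t+1}"
    then show "F k (x + real k) = \<beta> x"
      using \<beta>_piece[of "x + real k" "k"] t by simp
  qed
  ultimately have "(\<beta> has_integral integral {u..1} (F (Suc k)) + integral {0..u} (F k)) {t..t+1}"
    by (intro has_integral_combine[where c = "- real k"]) (use t in auto)
  moreover have "integral {u..1} (F (Suc k)) + integral {0..u} (F k) = \<rho> * (F (Suc k) u - F (Suc (Suc k)) u)"
  proof -
    have 1: "integral {u..1} (F (Suc k)) = \<rho> * (F (Suc k) 0 - F (Suc (Suc k)) u)"
      using F_integral_tail[of u "Suc k"] t unfolding F_glue by simp
    show ?thesis unfolding 1 using F_integral[of u k] t by (simp add: algebra_simps)
  qed
  moreover have "t - 1 = u - real (Suc (Suc k))" using t by simp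
  then have "\<beta> t = F (Suc k) u" "\<beta> (t - 1) = F (Suc (Suc k)) u"
    using \<beta>_piece[of u "Suc k"] \<beta>_piece[of u "Suc (Suc k)"] t by (simp_all only:)
  ultimately show ?thesis by simp
qed

lemma \<beta>_integral_neg:
  assumes "t < 0"
  shows "(\<beta> has_integral \<rho> * (\<beta> t - \<beta> (t - real n))) {t + 1 - real n..t+1}"
proof (induction n)
  case 0 show ?case by (simp add: has_integral_refl)
next
  case (Suc n)
  have "(\<beta> has_integral \<rho> * (\<beta> (t - real n) - \<beta> (t - real n - 1))) {t - real n..t - real n + 1}"
    using assms by (intro \<beta>_unit_integral) auto
  then have "(\<beta> has_integral \<rho> * (\<beta> (t - real n) - \<beta> (t - real n - 1)) + \<rho> * (\<beta> t - \<beta> (t - real n))) {t - real n..t+1}"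
    using Suc by (intro has_integral_combine[where c = "t + 1 - real n"]) (auto simp: algebra_simps)
  moreover have "t + 1 - real (Suc n) = t - real n" "t - real (Suc n) = t - real n - 1" by auto
  ultimately show ?case by (simp add: algebra_simps)
qed

lemma \<beta>_integral_to_one: "(\<beta> has_integral \<rho> * (y - \<beta> (- 1 - real n))) {- real n..1}"
proof -
  have "(\<beta> has_integral \<rho> * (\<beta> (- 1) - \<beta> (- 1 - real n))) {- real n..0}"
    using \<beta>_integral_neg[of "- 1" n] by simp
  moreover have "(\<beta> has_integral integral {0..1} (F 0)) {0..1}"
    by (rule has_integral_eq[OF _ integrable_integral[OF F_integrable]]) (auto simp: \<beta>_def F.simps(1))
  ultimately have "(\<beta> has_integral \<rho> * (\<beta> (- 1) - \<beta> (- 1 - real n)) + integral {0..1} (F 0)) {- real n..1}"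
    by (intro has_integral_combine[where c = 0]) auto
  moreover have "\<beta> (- 1) = F 1 0" using \<beta>_piece[of 0 1] by simp
  moreover have "integral {0..1} (F 0) = \<rho> * (y - F 1 0)" using F_integral[of 1 0] F_1_1 by simp
  ultimately show ?thesis by (simp add: algebra_simps)
qed

lemma \<beta>_integral_from_one:
  assumes "0 \<le> t"
  shows "(\<beta> has_integral (exp (s * (t + 1 - p)) - exp (s * (1 - p))) / s) {1..t+1}"
proof (rule has_integral_eq)
  have "((\<lambda>x. exp (s * (x - p))) has_integral exp (s * (t + 1 - p)) / s - exp (s * (1 - p)) / s) {1..t+1}"
    using assms s by (intro fundamental_theorem_of_calculus)
      (auto simp flip: has_real_derivative_iff_has_vector_derivative intro!: derivative_eq_intros)
  then show "((\<lambda>x. exp (s * (x - p))) has_integral (exp (s * (t + 1 - p)) - exp (s * (1 - p))) / s) {1..t+1}"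
    by (simp add: diff_divide_distrib)
  show "exp (s * (x - p)) = \<beta> x" if "x \<in> {1..t+1}" for x using that p by (simp add: \<beta>_def)
qed

section \<open>The value-weighted measure of the curve\<close>

lemma \<beta>_borel [measurable]: "\<beta> \<in> borel_measurable borel"
  using \<beta>_mono by (rule borel_measurable_mono)

text \<open>For uniform U the bids sit at the positions n + U; \<open>\<nu>\<close> of a set of
  positions is the expected sum of the bids placed there.\<close>

definition \<nu> :: "real measure" where "\<nu> = density lborel (\<lambda>x. ennreal (\<beta> x))"

lemma sets_\<nu> [simp, measurable_cong]: "sets \<nu> = sets borel" by (simp add: \<nu>_def)

lemma emeasure_\<nu>_Icc: assumes "(\<beta> has_integral I) {a..b}" shows "emeasure \<nu> {a..b} = ennreal I"
proof -
  have "((\<lambda>x. if x \<in> {a..b} then \<beta> x else 0) has_integral I) UNIV"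
    using assms by (simp only: has_integral_restrict_UNIV)
  then have "(\<integral>\<^sup>+ x. ennreal (if x \<in> {a..b} then \<beta> x else 0) \<partial>lborel) = ennreal I"
    by (intro nn_integral_has_integral_lborel) (auto simp: \<beta>_pos less_imp_le)
  moreover have "emeasure \<nu> {a..b} = (\<integral>\<^sup>+ x. ennreal (if x \<in> {a..b} then \<beta> x else 0) \<partial>lborel)"
    unfolding \<nu>_def by (simp add: emeasure_density) (intro nn_integral_cong, auto simp: indicator_def)
  ultimately show ?thesis by simp
qed

lemma emeasure_\<nu>_atMost_le:
  assumes "\<And>n::nat. \<exists>I a. a \<le> c - real n \<and> (\<beta> has_integral I) {a..c} \<and> I \<le> C"
  shows "emeasure \<nu> {..c} \<le> ennreal C"
proof -
  have "emeasure \<nu> {..c} = (SUP n::nat. emeasure \<nu> {c - real n..c})"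
  proof -
    have "{..c} = (\<Union>n::nat. {c - real n..c})"
    proof (intro set_eqI iffI)
      fix x assume "x \<in> {..c}"
      obtain n :: nat where "c - x \<le> real n" using real_arch_simple by blast
      then show "x \<in> (\<Union>n::nat. {c - real n..c})" using \<open>x \<in> {..c}\<close> by (auto intro!: exI[of _ n])
    qed auto
    then show ?thesis by (subst SUP_emeasure_incseq) (auto simp: incseq_def)
  qed
  also have "\<dots> \<le> ennreal C"
  proof (rule SUP_least)
    fix n :: nat
    obtain I a where I: "a \<le> c - real n" "(\<beta> has_integral I) {a..c}" "I \<le> C" using assms by blast
    have "emeasure \<nu> {c - real n..c} \<le> emeasure \<nu> {a..c}" using I by (intro emeasure_mono) auto
    also have "\<dots> \<le> ennreal C" using emeasure_\<nu>_Icc[OF I(2)] I(3) by (simp add: ennreal_leI)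
    finally show "emeasure \<nu> {c - real n..c} \<le> ennreal C" .
  qed
  finally show ?thesis .
qed

lemma emeasure_\<nu>_one: "emeasure \<nu> {..1} \<le> ennreal (\<rho> * y)"
proof (rule emeasure_\<nu>_atMost_le)
  fix n :: nat
  have "\<rho> * (y - \<beta> (- 1 - real n)) \<le> \<rho> * y" using \<beta>_pos[of "- 1 - real n"] s by (intro mult_left_mono) auto
  then show "\<exists>I a. a \<le> 1 - real n \<and> (\<beta> has_integral I) {a..1} \<and> I \<le> \<rho> * y"
    using \<beta>_integral_to_one[of n] by (intro exI[of _ "\<rho> * (y - \<beta> (- 1 - real n))"] exI[of _ "- real n"]) auto
qed

text \<open>Robustness of the curve. For negative t the unit integrals telescope. For other t the
  mass up to 1 is at most \<open>\<rho> * y\<close>, and \<open>y_le\<close> lets the remaining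
  exponential integral absorb the excess.\<close>

lemma emeasure_\<nu>_le: "emeasure \<nu> {..t+1} \<le> ennreal (\<rho> * \<beta> t)"
proof (rule emeasure_\<nu>_atMost_le)
  fix n :: nat
  show "\<exists>I a. a \<le> t + 1 - real n \<and> (\<beta> has_integral I) {a..t+1} \<and> I \<le> \<rho> * \<beta> t"
  proof (cases "t < 0")
    case True
    have "\<rho> * (\<beta> t - \<beta> (t - real n)) \<le> \<rho> * \<beta> t" using \<beta>_pos[of "t - real n"] s by (intro mult_left_mono) auto
    then show ?thesis using \<beta>_integral_neg[OF True, of n] by blast
  next
    case False
    obtain m :: nat where m: "real n \<le> real m" "real n - t - 1 \<le> real m"
      using real_arch_simple[of "max (real n) (real n - t - 1)"] by auto
    define I where "I = \<rho> * (y - \<beta> (- 1 - real m)) + (exp (s * (t + 1 - p)) - exp (s * (1 - p))) / s"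
    have "(\<beta> has_integral I) {- real m..t+1}"
      unfolding I_def using False \<beta>_integral_to_one \<beta>_integral_from_one
      by (intro has_integral_combine[where c = 1]) auto
    moreover have "I \<le> \<rho> * \<beta> t"
    proof -
      have "\<rho> * (y - \<beta> (- 1 - real m)) \<le> \<rho> * exp (- s * p)"
        using \<beta>_pos[of "- 1 - real m"] s y_le by (intro mult_left_mono) auto
      also have "\<rho> * exp (- s * p) = exp (s * (1 - p)) / s" by (simp add: mult_exp_exp algebra_simps)
      finally have "I \<le> exp (s * (t + 1 - p)) / s" unfolding I_def by (simp add: diff_divide_distrib)
      also have "\<dots> = \<rho> * exp (s * (t - p))" by (simp add: mult_exp_exp algebra_simps)
      also have "\<dots> \<le> \<rho> * \<beta> t" using False s unfolding \<beta>_def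
        by (intro mult_left_mono) auto
      finally show ?thesis .
    qed
    moreover have "- real m \<le> t + 1 - real n" using m by simp
    ultimately show ?thesis by blast
  qed
qed

text \<open>Monotonicity bounds the unit integral below by \<open>\<beta> t\<close>, so a unit step
  to the left of 0 contracts the curve by the factor \<open>1 - 1 / \<rho>\<close>.\<close>

lemma \<beta>_tendsto_0: assumes "0 < T" shows "\<exists>n::nat. \<beta> (t - real n) < T"
proof -
  define q where "q = 1 - 1 / \<rho>"
  have "s < exp s" using exp_ge_add_one_self[of s] by linarith
  then have q: "0 < q" "q < 1" using s by (auto simp: q_def field_simps)
  have step: "\<beta> (t - 1) \<le> q * \<beta> t" if "t < 0" for t
  proof -
    have "\<beta> t \<le> \<rho> * (\<beta> t - \<beta> (t - 1))"
    proof (rule has_integral_le)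
      show "((\<lambda>_. \<beta> t) has_integral \<beta> t) {t..t+1}" using has_integral_const_real[of "\<beta> t" t "t + 1"] by simp
      show "(\<beta> has_integral \<rho> * (\<beta> t - \<beta> (t - 1))) {t..t+1}" using that by (rule \<beta>_unit_integral)
    qed (use \<beta>_mono in \<open>auto dest: monoD\<close>)
    then show ?thesis using s by (simp add: q_def field_simps)
  qed
  have iter: "\<beta> (- 1 - real n) \<le> q ^ n * \<beta> (- 1)" for n
  proof (induction n)
    case (Suc n)
    have "\<beta> (- 1 - real (Suc n)) \<le> q * \<beta> (- 1 - real n)" using step[of "- 1 - real n"] by (simp add: algebra_simps)
    also have "\<dots> \<le> q * (q ^ n * \<beta> (- 1))" using Suc q by (intro mult_left_mono) auto
    finally show ?case by (simp add: mult.assoc)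
  qed simp
  obtain n where n: "q ^ n < T / \<beta> (- 1)" using real_arch_pow_inv[of "T / \<beta> (- 1)" q] assms q \<beta>_pos by auto
  obtain m :: nat where m: "t + 1 + real n \<le> real m" using real_arch_simple by blast
  have "\<beta> (t - real m) \<le> \<beta> (- 1 - real n)" using m by (intro monoD[OF \<beta>_mono]) auto
  also have "\<dots> \<le> q ^ n * \<beta> (- 1)" by (rule iter)
  also have "\<dots> < T" using n \<beta>_pos[of "- 1"] by (simp add: field_simps)
  finally show ?thesis by blast
qed

lemma \<beta>_unbounded: "\<exists>n::nat. T \<le> \<beta> (t + real n)"
proof -
  obtain n :: nat where n: "max (\<bar>t\<bar>) (T / s - t + p) \<le> real n" using real_arch_simple by blast
  have "T \<le> s * (t + real n - p)" using n s by (simp add: field_simps)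
  also have "\<dots> \<le> s * max 0 (t + real n - p)" using s by (intro mult_left_mono) auto
  also have "\<dots> \<le> exp (s * max 0 (t + real n - p))" using exp_ge_add_one_self[of "s * max 0 (t + real n - p)"] by linarith
  also have "\<dots> = \<beta> (t + real n)" using n by (intro \<beta>_nonneg_arg[symmetric]) linarith
  finally show ?thesis by blast
qed

section \<open>The randomized strategy and its expected costs\<close>

definition bids :: "real \<Rightarrow> int \<Rightarrow> real" where "bids u = (\<lambda>n. \<beta> (of_int n + u))"

lemma strategy_bids: assumes "0 < u" "u < 1" shows "strategy (bids u)"
proof -
  have "strict_mono (bids u)"
  proof (rule strict_monoI)
    fix m n :: int assume "m < n"
    have "\<beta> (of_int m + u) < \<beta> (of_int m + u + 1)" using assms by (rule \<beta>_strict)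
    also have "\<dots> \<le> \<beta> (of_int n + u)" using \<open>m < n\<close> by (intro monoD[OF \<beta>_mono]) simp
    finally show "bids u m < bids u n" by (simp add: bids_def)
  qed
  then show ?thesis by (simp add: strategy_def bids_def \<beta>_pos)
qed

lemma bids_crossing: assumes "0 < u" "u < 1" "0 < T" shows "\<exists>n. T \<le> bids u n \<and> bids u (n - 1) < T"
proof -
  obtain m :: nat where "\<beta> (u - real m) < T" using \<beta>_tendsto_0[OF assms(3)] by blast
  then have "bids u (- int m) < T" by (simp add: bids_def)
  moreover obtain n :: nat where "T \<le> \<beta> (u + real n)" using \<beta>_unbounded by blast
  then have "T \<le> bids u (int n)" by (simp add: bids_def add.commute)
  ultimately show ?thesis using crossing_exists[OF strategy_bids[OF assms(1,2)]] by blast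
qed

definition M :: "(int \<Rightarrow> real) measure" where
  "M = distr (uniform_measure lborel {0<..<1}) (Pi\<^sub>M UNIV (\<lambda>_. borel)) bids"

lemma bids_measurable [measurable]: "bids \<in> borel \<rightarrow>\<^sub>M Pi\<^sub>M UNIV (\<lambda>_. borel)"
proof -
  have "(\<lambda>u. \<lambda>n\<in>UNIV. \<beta> (of_int n + u)) \<in> borel \<rightarrow>\<^sub>M Pi\<^sub>M UNIV (\<lambda>_. borel)"
    by (rule measurable_restrict) measurable
  moreover have "bids = (\<lambda>u. \<lambda>n\<in>UNIV. \<beta> (of_int n + u))" by (intro ext) (simp add: bids_def)
  ultimately show ?thesis by simp
qed

lemma bids_measurable_uniform [measurable]:
  "bids \<in> uniform_measure lborel {0<..<1} \<rightarrow>\<^sub>M Pi\<^sub>M UNIV (\<lambda>_. borel)"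
proof -
  have eq: "sets (uniform_measure lborel {0<..<1::real}) = sets borel" by simp
  show ?thesis unfolding measurable_cong_sets[OF eq refl] by (rule bids_measurable)
qed

lemma AE_M:
  assumes "Measurable.pred (Pi\<^sub>M UNIV (\<lambda>_. borel)) P" "\<And>u. 0 < u \<Longrightarrow> u < 1 \<Longrightarrow> P (bids u)"
  shows "AE b in M. P b"
  unfolding M_def using assms bids_measurable_uniform
  by (subst AE_distr_iff) (auto intro!: AE_uniform_measureI simp: pred_def)

lemma randomized_M: "randomized_strategy M"
  unfolding randomized_strategy_def
proof (intro conjI)
  show "prob_space M" unfolding M_def
    by (intro prob_space.prob_space_distr prob_space_uniform_measure bids_measurable_uniform) auto
  show "sets M = sets (Pi\<^sub>M UNIV (\<lambda>_. borel))" by (simp add: M_def)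
  show "AE b in M. strategy b" by (rule AE_M[OF strategy_measurable strategy_bids])
qed

text \<open>The bid at position x is paid exactly when the bid at position x - 1 is below T.
  Exchanging sum and integral glues the unit intervals of positions into the whole line.\<close>

lemma exp_cost_M_le:
  assumes "0 < T"
  shows "exp_cost M T \<le> emeasure \<nu> {x. \<beta> (x - 1) < T}"
proof -
  define A where "A = {x. \<beta> (x - 1) < T}"
  have A [measurable]: "A \<in> sets borel" unfolding A_def by measurable
  have "AE b in M. strategy b \<and> (\<exists>n. T \<le> b n \<and> b (n - 1) < T)"
    by (rule AE_M) (auto simp: strategy_bids bids_crossing assms)
  then have "AE b in M. cost b T = bid_sum b T" by eventually_elim (simp add: cost_strategy)
  then have "exp_cost M T = (\<integral>\<^sup>+ b. bid_sum b T \<partial>M)" unfolding exp_cost_def by (rule nn_integral_cong_AE)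
  also have "\<dots> = (\<integral>\<^sup>+ u. bid_sum (bids u) T \<partial>uniform_measure lborel {0<..<1})"
    unfolding M_def by (rule nn_integral_distr[OF bids_measurable_uniform]) (simp add: bid_sum_measurable)
  also have "\<dots> = (\<integral>\<^sup>+ u. bid_sum (bids u) T * indicator {0<..<1} u \<partial>lborel)"
    using measurable_compose[OF bids_measurable bid_sum_measurable]
    by (subst nn_integral_uniform_measure) (simp_all add: divide_ennreal_def)
  also have "\<dots> = (\<integral>\<^sup>+ u. \<integral>\<^sup>+ n. ennreal (\<beta> (of_int n + u)) * indicator A (of_int n + u)
      * indicator {0<..<1} u \<partial>count_space UNIV \<partial>lborel)"
  proof (rule nn_integral_cong)
    fix u :: real
    have "indicator {n. \<beta> (of_int (n - 1) + u) < T} n = (indicator A (of_int n + u) :: ennreal)" for n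
      by (simp add: A_def indicator_def algebra_simps)
    then show "bid_sum (bids u) T * indicator {0<..<1} u
      = (\<integral>\<^sup>+ n. ennreal (\<beta> (of_int n + u)) * indicator A (of_int n + u) * indicator {0<..<1} u \<partial>count_space UNIV)"
      unfolding bid_sum_def bids_def by (subst nn_integral_multc) simp_all
  qed
  also have "\<dots> = (\<integral>\<^sup>+ n. \<integral>\<^sup>+ u. ennreal (\<beta> (of_int n + u)) * indicator A (of_int n + u)
      * indicator {0<..<1} u \<partial>lborel \<partial>count_space UNIV)"
    by (rule nn_integral_count_space_nn_integral) simp_all
  also have "\<dots> = (\<integral>\<^sup>+ n. \<integral>\<^sup>+ x. ennreal (\<beta> x) * indicator A x
      * indicator {of_int n<..<of_int n + 1} x \<partial>lborel \<partial>count_space UNIV)"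
  proof (rule nn_integral_cong)
    fix n :: int
    show "(\<integral>\<^sup>+ u. ennreal (\<beta> (of_int n + u)) * indicator A (of_int n + u)
      * indicator {0<..<1} u \<partial>lborel) = (\<integral>\<^sup>+ x. ennreal (\<beta> x) * indicator A x
      * indicator {of_int n<..<of_int n + 1} x \<partial>lborel)"
      by (subst nn_integral_real_affine[where c = 1 and t = "of_int n"])
        (auto intro!: nn_integral_cong split: split_indicator)
  qed
  also have "\<dots> = (\<integral>\<^sup>+ x. \<integral>\<^sup>+ n. ennreal (\<beta> x) * indicator A x
      * indicator {of_int n<..<of_int n + 1} x \<partial>count_space UNIV \<partial>lborel)"
    by (rule nn_integral_count_space_nn_integral[symmetric]) simp_all
  \<comment> \<open>The open unit intervals are disjoint, so each x is counted at most once.\<close>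
  also have "\<dots> \<le> (\<integral>\<^sup>+ x. ennreal (\<beta> x) * indicator A x \<partial>lborel)"
  proof (rule nn_integral_mono)
    fix x :: real
    have "(\<integral>\<^sup>+ n. indicator {of_int n<..<of_int n + 1} x \<partial>count_space UNIV)
      \<le> (\<integral>\<^sup>+ n. indicator {\<lfloor>x\<rfloor>} n \<partial>count_space UNIV)"
      by (intro nn_integral_mono) (auto simp: indicator_def intro!: floor_unique[symmetric])
    also have "\<dots> = 1" by simp
    finally have "ennreal (\<beta> x) * indicator A x *
        (\<integral>\<^sup>+ n. indicator {of_int n<..<of_int n + 1} x \<partial>count_space UNIV)
      \<le> ennreal (\<beta> x) * indicator A x * 1" by (intro mult_left_mono) auto
    then show "(\<integral>\<^sup>+ n. ennreal (\<beta> x) * indicator A x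
      * indicator {of_int n<..<of_int n + 1} x \<partial>count_space UNIV) \<le> ennreal (\<beta> x) * indicator A x"
      by (simp add: nn_integral_cmult)
  qed
  also have "\<dots> = emeasure \<nu> A"
    unfolding \<nu>_def by (subst emeasure_density) simp_all
  finally show ?thesis unfolding A_def .
qed

lemma consistent_M: "consistent M (\<rho> * y)"
proof -
  have "{x. \<beta> (x - 1) < 1} \<subseteq> {..1}"
  proof
    fix x assume "x \<in> {x. \<beta> (x - 1) < 1}"
    moreover have "1 \<le> \<beta> (x - 1)" if "0 \<le> x - 1" using that s by (simp add: \<beta>_def)
    ultimately have "\<not> 0 \<le> x - 1" by fastforce
    then show "x \<in> {..1}" by simp
  qed
  then have "emeasure \<nu> {x. \<beta> (x - 1) < 1} \<le> emeasure \<nu> {..1}" by (intro emeasure_mono) auto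
  then show ?thesis unfolding consistent_def
    using exp_cost_M_le[of 1] emeasure_\<nu>_one by simp
qed

text \<open>The curve may jump past T at the supremum \<open>\<tau>\<close> of positions below T, so
  \<open>emeasure_\<nu>_le\<close> is applied only at points before \<open>\<tau>\<close> and the
  bound is carried over by continuity from below.\<close>

lemma robust_M: "robust M \<rho>"
  unfolding robust_def
proof (intro allI impI)
  fix T :: real assume T: "0 < T"
  define A where "A = {t. \<beta> t < T}"
  define \<tau> where "\<tau> = Sup A"
  obtain t0 where t0: "t0 \<in> A" using \<beta>_tendsto_0[OF T, of 0] by (auto simp: A_def)
  obtain B where B: "T \<le> \<beta> B" using \<beta>_unbounded[of T 0] by blast
  have bdd: "bdd_above A"
  proof (rule bdd_aboveI)
    fix t assume "t \<in> A"
    then show "t \<le> B" using B monoD[OF \<beta>_mono, of B t] by (force simp: A_def)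
  qed
  have bound: "emeasure \<nu> {..t+1} \<le> ennreal (\<rho> * T)" if "t < \<tau>" for t
  proof -
    have "\<exists>t1\<in>A. t < t1" by (rule less_cSupD) (use t0 that in \<open>auto simp: \<tau>_def\<close>)
    then obtain t1 where "t1 \<in> A" "t < t1" by blast
    then have "\<beta> t \<le> T" using monoD[OF \<beta>_mono, of t t1] by (simp add: A_def)
    then have "ennreal (\<rho> * \<beta> t) \<le> ennreal (\<rho> * T)" using s by (intro ennreal_leI mult_left_mono) auto
    then show ?thesis using emeasure_\<nu>_le[of t] by simp
  qed
  have "exp_cost M T \<le> emeasure \<nu> {x. \<beta> (x - 1) < T}" using T by (rule exp_cost_M_le)
  also have "\<dots> \<le> emeasure \<nu> {..\<tau>+1}"
  proof (intro emeasure_mono subsetI)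
    fix x assume "x \<in> {x. \<beta> (x - 1) < T}"
    then have "x - 1 \<le> \<tau>" unfolding \<tau>_def by (intro cSup_upper bdd) (simp add: A_def)
    then show "x \<in> {..\<tau>+1}" by simp
  qed simp
  \<comment> \<open>A measure with a Lebesgue density has no atom at the endpoint.\<close>
  also have "\<dots> = emeasure \<nu> {..<\<tau>+1}"
    unfolding \<nu>_def using AE_lborel_singleton[of "\<tau> + 1"]
    by (simp add: emeasure_density) (intro nn_integral_cong_AE, auto elim!: eventually_mono simp: indicator_def)
  also have "\<dots> = (SUP n::nat. emeasure \<nu> {..\<tau> - 1 / real (Suc n) + 1})"
  proof -
    have "{..<\<tau>+1} = (\<Union>n::nat. {..\<tau> - 1 / real (Suc n) + 1})"
    proof (intro set_eqI iffI)
      fix x assume "x \<in> {..<\<tau>+1}"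
      then obtain n where "1 / real (Suc n) < \<tau> + 1 - x"
        using reals_Archimedean[of "\<tau> + 1 - x"] by (auto simp: inverse_eq_divide)
      then show "x \<in> (\<Union>n::nat. {..\<tau> - 1 / real (Suc n) + 1})" by (auto intro!: exI[of _ n])
    next
      fix x assume "x \<in> (\<Union>n::nat. {..\<tau> - 1 / real (Suc n) + 1})"
      then obtain n :: nat where "x \<le> \<tau> - 1 / real (Suc n) + 1" by auto
      moreover have "0 < 1 / real (Suc n)" by simp
      ultimately show "x \<in> {..<\<tau>+1}" unfolding lessThan_iff by linarith
    qed
    then show ?thesis by (subst SUP_emeasure_incseq) (auto simp: incseq_def intro!: divide_left_mono)
  qed
  also have "\<dots> \<le> ennreal (\<rho> * T)" by (intro SUP_least bound) simp
  finally show "exp_cost M T \<le> ennreal (\<rho> * T)" .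
qed

end

theorem theorem1:
  fixes s :: real
  assumes "0 < s" and "s \<le> 1"
  shows "(\<exists>M. randomized_strategy M \<and> robust M (rho s) \<and> consistent M (chi s))
    \<and> \<not> (\<exists>M \<rho>'. \<rho>' < rho s \<and> randomized_strategy M \<and> robust M \<rho>' \<and> consistent M (chi s))"
proof -
  obtain p y where p: "0 \<le> p" "p \<le> 1"
    and y: "y = 1 - exp (- s * p) + s * (1 - p) * exp (- s * p)"
    and y_le: "y \<le> exp (- s * p)" and y_kink: "(1 - p) * y = (1 - p) * exp (- s * p)"
    and chi: "chi s = exp s * y / s"
    using curve_parameters[OF assms] .
  show ?thesis
  proof (intro conjI notI)
    interpret C: bidding_curve s p y
      using assms p y y_le by unfold_locales
    show "\<exists>M. randomized_strategy M \<and> robust M (rho s) \<and> consistent M (chi s)"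
      using C.randomized_M C.robust_M C.consistent_M by (auto simp: rho_def chi)
  next
    assume "\<exists>M \<rho>'. \<rho>' < rho s \<and> randomized_strategy M \<and> robust M \<rho>' \<and> consistent M (chi s)"
    then obtain M \<rho>' where less: "\<rho>' < exp s / s" and M: "randomized_strategy M" "robust M \<rho>'"
      and cons: "consistent M (chi s)"
      by (auto simp: rho_def)
    interpret R: robust_strategy M \<rho>'
      using M by unfold_locales
    have "ennreal (R.mean_cost 1) \<le> ennreal (chi s)"
      using cons R.exp_cost_mean_cost[of 1] by (simp add: consistent_def)
    then have le: "R.mean_cost 1 \<le> exp s * y / s"
      using R.mean_cost_pos[of 1] unfolding chi by (cases "0 \<le> exp s * y / s") (auto simp: ennreal_neg)
    have "s * (1 - p) \<le> 1 * 1"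
      using assms p by (intro mult_mono) auto
    then have "R.mean_cost 1 * (1 - s * (1 - p)) \<le> exp s * y / s * (1 - s * (1 - p))"
      using le by (intro mult_right_mono) auto
    also have "\<dots> = exp s / s * (y - s * ((1 - p) * y))"
      using assms by (simp add: field_simps)
    \<comment> \<open>Complementarity replaces y by \<open>exp (- s * p)\<close> in the second term,
      after which \<open>y_eq\<close> makes the upper bound on the mean cost contradict the strict
      lower bound.\<close>
    also have "y - s * ((1 - p) * y) = 1 - exp (- s * p)"
      unfolding y_kink using y by (simp only: mult.assoc)
    finally show False
      using R.mean_cost_one_gt[OF assms less p] by simp
  qed
qed

end
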